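(* Let $m \geq 2$ be an integer and let $\varphi:\mathbf{R}^d\to\mathbf{R}$ be a real polynomial of order $m$, $\varphi(x)=\varphi_m(x)+p(x)$, where $p(x)=\sum_{0\leq|\alpha|<m}c_\alpha x^\alpha$ with $c_\alpha\in\mathbf{R}$, and the principal part is $\varphi_m(x)=\sum_{|\alpha|=m}c_\alpha x^\alpha$ with $c_\alpha\in\mathbf{R}$ and $c_\alpha\neq 0$ for some $\alpha\in\mathbf{N}^d$ with $|\alpha|=m$. Let $u(x)=e^{i\varphi(x)}$, $x\in\mathbf{R}^d$. Then $$\mathrm{WF}_{\mathrm g}^{m-1}(u)\subseteq\{(x,\nabla\varphi_m(x))\in\mathbf{R}^{2d}:\ x\neq 0\}.$$ If $d=1$ and $\varphi$ is even or odd then $$\mathrm{WF}_{\mathrm g}^{m-1}(u)=\{(x,\varphi_m'(x))\in\mathbf{R}^2:\ x\neq 0\}.$$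
   Context: Identify $T^*\mathbf{R}^d$ with $\mathbf{R}^{2d}$. The notation $(u,f)$ is the action of $u\in\mathscr{S}'(\mathbf{R}^d)$ on $f\in\mathscr{S}(\mathbf{R}^d)$ that is conjugate linear in $f$ and consistent with the $L^2$ inner product. Short-time Fourier transform: for $u \in \mathscr{S}'(\mathbf{R}^d)$ and $\psi\in\mathscr{S}(\mathbf{R}^d)\setminus\{0\}$, $V_\psi u(x,\xi) = (2\pi)^{-d/2}(u, M_\xi T_x\psi)$, where $T_x f(y)=f(y-x)$ and $M_\xi f(y)=e^{i\langle y,\xi\rangle}f(y)$. Anisotropic $s$-Gabor wave front set: for $s>0$ and $u\in\mathscr{S}'(\mathbf{R}^d)$, $\mathrm{WF}_{\mathrm g}^s(u)\subseteq T^*\mathbf{R}^d\setminus 0$ is defined by: a point $z_0\in T^*\mathbf{R}^d\setminus 0$ satisfies $z_0\notin \mathrm{WF}_{\mathrm g}^s(u)$ if there is an open set $U\subseteq T^*\mathbf{R}^d$ with $z_0\in U$ and $\sup_{(x,\xi)\in U,\ \lambda>0}\lambda^N|V_\psi u(\lambda x,\lambda^s\xi)|<\infty$ for all $N\geq 0$. Here $\psi\in\mathscr{S}(\mathbf{R}^d)\setminus\{0\}$ is a fixed window; the set does not depend on the choice of $\psi$. *)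

theory Defs
  imports "HOL-Analysis.Analysis" "HOL-Probability.Sinc_Integral"
begin

section \<open>Polynomials in several variables and gradients\<close>

text \<open>Multi-indices are functions \<open>'n \<Rightarrow> nat\<close>, where \<open>real ^ 'n\<close> is the Euclidean space
  of dimension \<open>CARD('n)\<close>.\<close>

definition mi_order :: "('n::finite \<Rightarrow> nat) \<Rightarrow> nat" where
  "mi_order \<alpha> = (\<Sum>i\<in>UNIV. \<alpha> i)"

definition mi_power :: "real ^ 'n \<Rightarrow> ('n::finite \<Rightarrow> nat) \<Rightarrow> real" where
  "mi_power x \<alpha> = (\<Prod>i\<in>UNIV. (x $ i) ^ \<alpha> i)"

definition grad :: "('a::real_inner \<Rightarrow> real) \<Rightarrow> 'a \<Rightarrow> 'a" where
  "grad f x = (THE D. GDERIV f x :> D)"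

lemma finite_mi_order_le: "finite {\<alpha> :: 'n::finite \<Rightarrow> nat. mi_order \<alpha> \<le> m}"
proof (rule finite_subset)
  show "{\<alpha> :: 'n \<Rightarrow> nat. mi_order \<alpha> \<le> m} \<subseteq> UNIV \<rightarrow>\<^sub>E {..m}"
  proof clarify
    fix \<alpha> :: "'n \<Rightarrow> nat" assume m: "mi_order \<alpha> \<le> m"
    have "\<alpha> i \<le> mi_order \<alpha>" for i
      unfolding mi_order_def by (rule member_le_sum) auto
    with m show "\<alpha> \<in> UNIV \<rightarrow>\<^sub>E {..m}"
      by (auto intro: order_trans)
  qed
  show "finite ((UNIV :: 'n set) \<rightarrow>\<^sub>E {..m})"
    by (intro finite_PiE) auto
qed

lemma finite_mi_order_eq: "finite {\<alpha> :: 'n::finite \<Rightarrow> nat. mi_order \<alpha> = m}"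
  by (rule finite_subset[OF _ finite_mi_order_le[of m]]) auto

lemma finite_mi_order_less: "finite {\<alpha> :: 'n::finite \<Rightarrow> nat. mi_order \<alpha> < m}"
  by (rule finite_subset[OF _ finite_mi_order_le[of m]]) auto

lemma grad_eqI:
  fixes f :: "'a::real_inner \<Rightarrow> real"
  assumes "GDERIV f x :> D"
  shows "grad f x = D"
  unfolding grad_def
proof (rule the_equality)
  show "GDERIV f x :> D" by fact
  fix E assume "GDERIV f x :> E"
  with assms have "(\<lambda>h. h \<bullet> E) = (\<lambda>h. h \<bullet> D)"
    unfolding gderiv_def by (rule has_derivative_unique[rotated])
  then have "(E - D) \<bullet> E = (E - D) \<bullet> D" by metis
  then have "(E - D) \<bullet> (E - D) = 0" by (simp add: inner_diff_right)
  then show "E = D" by simp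
qed

section \<open>Schwartz functions and tempered distributions\<close>

definition partial :: "'n::finite \<Rightarrow> (real ^ 'n \<Rightarrow> complex) \<Rightarrow> real ^ 'n \<Rightarrow> complex" where
  "partial i f x = vector_derivative (\<lambda>t. f (x + t *\<^sub>R axis i 1)) (at 0)"

definition partials :: "'n::finite list \<Rightarrow> (real ^ 'n \<Rightarrow> complex) \<Rightarrow> real ^ 'n \<Rightarrow> complex" where
  "partials is f = foldr partial is f"

text \<open>Smoothness is differentiability of all iterated partial derivatives. For smooth functions
  the order of differentiation is irrelevant, so a list \<open>is\<close> represents the multi-index
  counting the occurrences of each index in it, and bounding \<open>(1 + norm x) ^ k * cmod (partials is f x)\<close>
  for all \<open>k\<close> and \<open>is\<close> is the same as bounding all \<open>x^\<alpha> \<partial>^\<beta> f\<close>.\<close>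

definition schwartz_space :: "(real ^ 'n::finite \<Rightarrow> complex) set" where
  "schwartz_space = {f.
     (\<forall>is x. partials is f differentiable (at x)) \<and>
     (\<forall>k is. bdd_above (range (\<lambda>x. (1 + norm x) ^ k * cmod (partials is f x))))}"

definition schwartz_norm :: "nat \<Rightarrow> (real ^ 'n::finite \<Rightarrow> complex) \<Rightarrow> real" where
  "schwartz_norm k f =
     (\<Sum>is | length is \<le> k. SUP x. (1 + norm x) ^ k * cmod (partials is f x))"

text \<open>The pairing \<open>(u, f)\<close> is \<open>u f\<close>. It is conjugate linear in \<open>f\<close>. Continuity is expressed by
  the increasing family of seminorms \<open>schwartz_norm k\<close>. The values of \<open>u\<close> outside
  \<open>schwartz_space\<close> carry no meaning.\<close>

definition tempered_distributions :: "((real ^ 'n::finite \<Rightarrow> complex) \<Rightarrow> complex) set" where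
  "tempered_distributions = {u.
     (\<forall>f\<in>schwartz_space. \<forall>g\<in>schwartz_space. u (\<lambda>x. f x + g x) = u f + u g) \<and>
     (\<forall>a. \<forall>f\<in>schwartz_space. u (\<lambda>x. a * f x) = cnj a * u f) \<and>
     (\<exists>C k. \<forall>f\<in>schwartz_space. cmod (u f) \<le> C * schwartz_norm k f)}"

definition distribution_of :: "(real ^ 'n::finite \<Rightarrow> complex) \<Rightarrow> (real ^ 'n \<Rightarrow> complex) \<Rightarrow> complex" where
  "distribution_of u f = (LINT x|lborel. u x * cnj (f x))"

section \<open>Short-time Fourier transform and the anisotropic Gabor wave front set\<close>

definition translation :: "real ^ 'n::finite \<Rightarrow> (real ^ 'n \<Rightarrow> complex) \<Rightarrow> real ^ 'n \<Rightarrow> complex" where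
  "translation x f = (\<lambda>y. f (y - x))"

definition modulation :: "real ^ 'n::finite \<Rightarrow> (real ^ 'n \<Rightarrow> complex) \<Rightarrow> real ^ 'n \<Rightarrow> complex" where
  "modulation \<xi> f = (\<lambda>y. exp (\<i> * complex_of_real (y \<bullet> \<xi>)) * f y)"

definition STFT ::
  "(real ^ 'n::finite \<Rightarrow> complex) \<Rightarrow> ((real ^ 'n \<Rightarrow> complex) \<Rightarrow> complex) \<Rightarrow> real ^ 'n \<Rightarrow> real ^ 'n \<Rightarrow> complex"
  where "STFT \<psi> u x \<xi> =
     complex_of_real ((2 * pi) powr (- real CARD('n) / 2)) * u (modulation \<xi> (translation x \<psi>))"

text \<open>The window \<open>\<psi>\<close> is kept as a parameter; for a tempered distribution \<open>u\<close> the set does not depend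
  on the choice of \<open>\<psi> \<in> schwartz_space\<close>, \<open>\<psi> \<noteq> 0\<close>.\<close>

definition WFg ::
  "real \<Rightarrow> (real ^ 'n::finite \<Rightarrow> complex) \<Rightarrow> ((real ^ 'n \<Rightarrow> complex) \<Rightarrow> complex) \<Rightarrow> ((real ^ 'n) \<times> (real ^ 'n)) set"
  where "WFg s \<psi> u = {z0. z0 \<noteq> 0 \<and>
     \<not> (\<exists>U. open U \<and> z0 \<in> U \<and>
          (\<forall>N::nat. bdd_above {l ^ N * cmod (STFT \<psi> u (l *\<^sub>R x) ((l powr s) *\<^sub>R \<xi>)) |
                               x \<xi> l. (x, \<xi>) \<in> U \<and> 0 < l}))}"

section \<open>Consistency of the definitions\<close>

subsection \<open>Translations and modulations act on Schwartz functions\<close>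

lemma partials_Nil [simp]: "partials [] f = f"
  and partials_Cons [simp]: "partials (i # is) f = partial i (partials is f)"
  and partials_snoc: "partials (is @ [i]) f = partials is (partial i f)"
  by (simp_all add: partials_def)

lemma has_partial:
  assumes "f differentiable (at x)"
  shows "((\<lambda>t. f (x + t *\<^sub>R axis i 1)) has_vector_derivative partial i f x) (at 0)"
proof -
  have "f differentiable (at (x + 0 *\<^sub>R axis i 1))" using assms by simp
  then have "(f \<circ> (\<lambda>t. x + t *\<^sub>R axis i 1)) differentiable (at (0::real))"
    by (intro differentiable_chain_at) (auto intro!: derivative_intros)
  then show ?thesis
    unfolding partial_def o_def by (simp add: vector_derivative_works[symmetric])
qed

lemma schwartz_differentiable: "f \<in> schwartz_space \<Longrightarrow> partials is f differentiable (at x)"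
  by (auto simp: schwartz_space_def)

lemma schwartz_bound:
  assumes "f \<in> schwartz_space"
  obtains C where "\<And>x. (1 + norm x) ^ k * cmod (partials is f x) \<le> C"
  using assms unfolding schwartz_space_def bdd_above_def by blast

lemma schwartz_spaceI:
  assumes "\<And>is x. partials is f differentiable (at x)"
    and "\<And>k is. \<exists>C. \<forall>x. (1 + norm x) ^ k * cmod (partials is f x) \<le> C"
  shows "f \<in> schwartz_space"
  using assms unfolding schwartz_space_def bdd_above_def by auto

lemma schwartz_partial: "f \<in> schwartz_space \<Longrightarrow> partial i f \<in> schwartz_space"
  unfolding schwartz_space_def by (simp add: partials_snoc[symmetric])

lemma schwartz_lincomb_aux:
  assumes f: "f \<in> schwartz_space" and g: "g \<in> schwartz_space"
  shows "partials is (\<lambda>x. a * f x + b * g x) = (\<lambda>x. a * partials is f x + b * partials is g x)"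
proof (induction "is")
  case (Cons i "is")
  show ?case unfolding partials_Cons Cons
  proof
    fix x
    have "((\<lambda>t. a * partials is f (x + t *\<^sub>R axis i 1) + b * partials is g (x + t *\<^sub>R axis i 1))
        has_vector_derivative (a * partial i (partials is f) x + b * partial i (partials is g) x)) (at 0)"
      by (intro has_vector_derivative_add has_vector_derivative_mult_right
            has_partial schwartz_differentiable f g)
    then show "partial i (\<lambda>x. a * partials is f x + b * partials is g x) x
      = a * partial i (partials is f) x + b * partial i (partials is g) x"
      unfolding partial_def[of i "\<lambda>x. a * partials is f x + b * partials is g x"]
      by (rule vector_derivative_at)
  qed
qed simp

lemma schwartz_lincomb:
  assumes f: "f \<in> schwartz_space" and g: "g \<in> schwartz_space"
  shows "(\<lambda>x. a * f x + b * g x) \<in> schwartz_space"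
proof (rule schwartz_spaceI)
  show "partials is (\<lambda>x. a * f x + b * g x) differentiable (at x)" for "is" x
    unfolding schwartz_lincomb_aux[OF f g]
    by (intro derivative_intros schwartz_differentiable f g)
  fix k "is"
  obtain C where C: "\<And>x. (1 + norm x) ^ k * cmod (partials is f x) \<le> C"
    using schwartz_bound[OF f] by blast
  obtain D where D: "\<And>x. (1 + norm x) ^ k * cmod (partials is g x) \<le> D"
    using schwartz_bound[OF g] by blast
  have "(1 + norm x) ^ k * cmod (partials is (\<lambda>x. a * f x + b * g x) x) \<le> cmod a * C + cmod b * D" for x
  proof -
    have "(1 + norm x) ^ k * cmod (partials is (\<lambda>x. a * f x + b * g x) x)
        \<le> (1 + norm x) ^ k * (cmod a * cmod (partials is f x) + cmod b * cmod (partials is g x))"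
      unfolding schwartz_lincomb_aux[OF f g] norm_mult[symmetric]
      by (intro mult_left_mono norm_triangle_ineq) auto
    also have "\<dots> = cmod a * ((1 + norm x) ^ k * cmod (partials is f x))
        + cmod b * ((1 + norm x) ^ k * cmod (partials is g x))"
      by (simp add: algebra_simps)
    also have "\<dots> \<le> cmod a * C + cmod b * D"
      by (intro add_mono mult_left_mono C D) auto
    finally show ?thesis .
  qed
  then show "\<exists>C. \<forall>x. (1 + norm x) ^ k * cmod (partials is (\<lambda>x. a * f x + b * g x) x) \<le> C" by blast
qed

lemma partials_translation: "partials is (translation x f) = translation x (partials is f)"
proof (induction "is")
  case (Cons i "is")
  have "partial i (translation x g) = translation x (partial i g)" for g :: "real ^ 'a \<Rightarrow> complex"
    by (rule ext) (simp add: partial_def translation_def algebra_simps)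
  with Cons show ?case by simp
qed simp

lemma translation_schwartz:
  assumes f: "f \<in> schwartz_space"
  shows "translation a f \<in> schwartz_space"
proof (rule schwartz_spaceI)
  show "partials is (translation a f) differentiable (at x)" for "is" x
  proof -
    have "(partials is f \<circ> (\<lambda>y. y - a)) differentiable (at x)"
      by (intro differentiable_chain_at schwartz_differentiable f) (auto intro!: derivative_intros)
    then show ?thesis by (simp only: partials_translation) (simp add: translation_def o_def)
  qed
  fix k "is"
  obtain C where C: "\<And>x. (1 + norm x) ^ k * cmod (partials is f x) \<le> C"
    using schwartz_bound[OF f] by blast
  have "(1 + norm x) ^ k * cmod (partials is (translation a f) x) \<le> (1 + norm a) ^ k * C" for x
  proof -
    have "norm x \<le> norm a + norm (x - a)" by norm
    also have "1 + \<dots> \<le> (1 + norm a) * (1 + norm (x - a))"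
      by (simp add: algebra_simps)
    finally have "(1 + norm x) ^ k \<le> (1 + norm a) ^ k * (1 + norm (x - a)) ^ k"
      unfolding power_mult_distrib[symmetric] by (intro power_mono) auto
    then have "(1 + norm x) ^ k * cmod (partials is f (x - a))
        \<le> (1 + norm a) ^ k * ((1 + norm (x - a)) ^ k * cmod (partials is f (x - a)))"
      unfolding mult.assoc[symmetric] by (intro mult_right_mono) auto
    also have "\<dots> \<le> (1 + norm a) ^ k * C" by (intro mult_left_mono C) auto
    finally show ?thesis by (simp only: partials_translation) (simp add: translation_def)
  qed
  then show "\<exists>C. \<forall>x. (1 + norm x) ^ k * cmod (partials is (translation a f) x) \<le> C" by blast
qed

lemma partial_modulation:
  assumes f: "\<And>x. f differentiable (at x)"
  shows "partial i (modulation \<xi> f) = modulation \<xi> (\<lambda>x. (\<i> * complex_of_real (\<xi> $ i)) * f x + 1 * partial i f x)"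
proof
  fix x
  let ?e = "\<lambda>t. exp (\<i> * complex_of_real ((x + t *\<^sub>R axis i 1) \<bullet> \<xi>))"
  have e: "((\<lambda>z. exp (\<i> * (complex_of_real (x \<bullet> \<xi>) + z * complex_of_real (\<xi> $ i)))) has_field_derivative
      (\<i> * complex_of_real (\<xi> $ i)) * exp (\<i> * complex_of_real (x \<bullet> \<xi>))) (at (complex_of_real 0))"
    by (auto intro!: derivative_eq_intros)
  have "(?e has_vector_derivative (\<i> * complex_of_real (\<xi> $ i)) * exp (\<i> * complex_of_real (x \<bullet> \<xi>))) (at 0)"
    using has_vector_derivative_real_field[OF e]
    by (simp add: inner_add_left inner_axis' o_def)
  from has_vector_derivative_mult[OF this has_partial[OF f, of x i]]
  have "partial i (modulation \<xi> f) x = ?e 0 * partial i f x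
      + \<i> * complex_of_real (\<xi> $ i) * exp (\<i> * complex_of_real (x \<bullet> \<xi>)) * f (x + 0 *\<^sub>R axis i 1)"
    unfolding partial_def[of i "modulation \<xi> f"]
    by (intro vector_derivative_at) (simp only: modulation_def)
  then show "partial i (modulation \<xi> f) x
      = modulation \<xi> (\<lambda>x. (\<i> * complex_of_real (\<xi> $ i)) * f x + 1 * partial i f x) x"
    by (simp add: modulation_def algebra_simps)
qed

lemma modulation_differentiable:
  assumes "f differentiable (at x)"
  shows "modulation \<xi> f differentiable (at x)"
proof -
  have "(\<lambda>y. \<i> * complex_of_real (y \<bullet> \<xi>)) differentiable (at x)"
    by (intro bounded_linear_imp_differentiable bounded_linear_const_mult
          bounded_linear_compose[OF bounded_linear_of_real] bounded_linear_inner_left)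
  moreover have "(exp :: complex \<Rightarrow> complex) differentiable (at z)" for z
    by (intro field_differentiable_imp_differentiable field_differentiable_within_exp)
  ultimately have "(exp \<circ> (\<lambda>y. \<i> * complex_of_real (y \<bullet> \<xi>))) differentiable (at x)"
    by (intro differentiable_chain_at)
  with assms show ?thesis
    unfolding modulation_def o_def by (intro differentiable_mult)
qed

lemma modulation_schwartz:
  assumes "f \<in> schwartz_space"
  shows "modulation \<xi> f \<in> schwartz_space"
proof -
  have "(\<forall>x. partials is (modulation \<xi> f) differentiable (at x)) \<and>
      (\<forall>k. \<exists>C. \<forall>x. (1 + norm x) ^ k * cmod (partials is (modulation \<xi> f) x) \<le> C)" for "is"
    using assms
  proof (induction "is" arbitrary: f rule: rev_induct)
    case Nil
    have "\<exists>C. \<forall>x. (1 + norm x) ^ k * cmod (f x) \<le> C" for k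
      using schwartz_bound[OF Nil, of k "[]"] by auto
    then show ?case
      using schwartz_differentiable[OF Nil, of "[]"]
      by (auto intro: modulation_differentiable) (simp add: modulation_def norm_mult)
  next
    case (snoc i "is")
    let ?g = "\<lambda>x. (\<i> * complex_of_real (\<xi> $ i)) * f x + 1 * partial i f x"
    have "?g \<in> schwartz_space"
      by (intro schwartz_lincomb schwartz_partial snoc.prems)
    moreover have "partials (is @ [i]) (modulation \<xi> f) = partials is (modulation \<xi> ?g)"
      unfolding partials_snoc
      using schwartz_differentiable[OF snoc.prems, of "[]"] by (subst partial_modulation) auto
    ultimately show ?case using snoc.IH[of ?g] by simp
  qed
  then show ?thesis by (intro schwartz_spaceI) auto
qed

subsection \<open>Bounded measurable functions are tempered distributions\<close>

lemma integrable_weight: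
  "integrable lborel (\<lambda>x::real ^ 'n::finite. inverse ((1 + norm x) ^ (2 * CARD('n))))"
proof (rule Bochner_Integration.integrable_bound)
  have fin: "(\<integral>\<^sup>+ t. ennreal (inverse (1 + t\<^sup>2)) \<partial>lborel) < \<infinity>"
  proof -
    have "integrable lborel (\<lambda>t::real. inverse (1 + t\<^sup>2))"
      using integrable_inverse_1_plus_square
      by (simp add: set_integrable_def)
    then show ?thesis
      by (simp add: integrable_iff_bounded)
  qed
  let ?w = "\<lambda>x::real ^ 'n. \<Prod>b\<in>Basis. inverse (1 + (x \<bullet> b)\<^sup>2)"
  show "integrable lborel ?w"
  proof (rule integrableI_bounded)
    show "?w \<in> borel_measurable lborel" by measurable
    have "(\<integral>\<^sup>+ x. ennreal (norm (?w x)) \<partial>lborel)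
        = (\<integral>\<^sup>+ x. (\<Prod>b\<in>Basis. ennreal (inverse (1 + (x \<bullet> b)\<^sup>2))) \<partial>(lborel :: (real ^ 'n) measure))"
      by (intro nn_integral_cong) (auto simp: prod_ennreal prod_nonneg abs_prod)
    also have "\<dots> = (\<Prod>b\<in>(Basis :: (real ^ 'n) set). \<integral>\<^sup>+ t. ennreal (inverse (1 + t\<^sup>2)) \<partial>lborel)"
      by (rule nn_integral_lborel_prod) auto
    also have "\<dots> < \<infinity>" using fin by (simp add: less_top[symmetric] power_eq_top_ennreal)
    finally show "(\<integral>\<^sup>+ x. ennreal (norm (?w x)) \<partial>lborel) < \<infinity>" .
  qed
  show "(\<lambda>x::real ^ 'n. inverse ((1 + norm x) ^ (2 * CARD('n)))) \<in> borel_measurable lborel"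
    by measurable
  show "AE x::real ^ 'n in lborel. norm (inverse ((1 + norm x) ^ (2 * CARD('n)))) \<le> norm (?w x)"
  proof (intro AE_I2)
    fix x :: "real ^ 'n"
    have "(\<Prod>b\<in>Basis. 1 + (x \<bullet> b)\<^sup>2) \<le> (\<Prod>b\<in>(Basis :: (real ^ 'n) set). (1 + norm x)\<^sup>2)"
    proof (intro prod_mono conjI)
      fix b :: "real ^ 'n" assume b: "b \<in> Basis"
      have "\<bar>x \<bullet> b\<bar>\<^sup>2 \<le> (norm x)\<^sup>2" using Basis_le_norm[OF b] by (intro power_mono) auto
      then show "1 + (x \<bullet> b)\<^sup>2 \<le> (1 + norm x)\<^sup>2" by (simp add: power2_eq_square algebra_simps)
           (smt (verit) norm_ge_zero)
    qed auto
    also have "\<dots> = (1 + norm x) ^ (2 * CARD('n))"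
      by (simp add: power_mult)
    finally have le: "(\<Prod>b\<in>Basis. 1 + (x \<bullet> b)\<^sup>2) \<le> (1 + norm x) ^ (2 * CARD('n))" .
    have pos: "0 < (\<Prod>b\<in>Basis. 1 + (x \<bullet> b)\<^sup>2)"
      by (intro prod_pos) (auto intro: add_pos_nonneg)
    have "inverse ((1 + norm x) ^ (2 * CARD('n))) \<le> inverse (\<Prod>b\<in>Basis. 1 + (x \<bullet> b)\<^sup>2)"
      using le pos by (rule le_imp_inverse_le)
    then show "norm (inverse ((1 + norm x) ^ (2 * CARD('n)))) \<le> norm (?w x)"
      by (simp add: prod_inversef[symmetric] o_def abs_prod)
  qed
qed

lemma schwartz_measurable:
  assumes "f \<in> schwartz_space" shows "f \<in> borel_measurable lborel"
proof -
  have "continuous_on UNIV f"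
    using schwartz_differentiable[OF assms, of "[]"]
    by (intro differentiable_imp_continuous_on) (auto simp: differentiable_on_def)
  then show ?thesis by (simp add: borel_measurable_continuous_onI)
qed

lemma schwartz_norm_bound:
  assumes f: "f \<in> schwartz_space"
  shows "(1 + norm x) ^ k * cmod (f x) \<le> schwartz_norm k f"
proof -
  have bdd: "bdd_above (range (\<lambda>x. (1 + norm x) ^ k * cmod (partials is f x)))" for "is"
    using f by (auto simp: schwartz_space_def)
  let ?S = "\<lambda>is. SUP x. (1 + norm x) ^ k * cmod (partials is f x)"
  have ge: "(1 + norm x) ^ k * cmod (partials is f x) \<le> ?S is" for "is" x
    by (rule cSUP_upper[OF _ bdd]) auto
  have S0: "0 \<le> ?S is" for "is"
    by (rule order_trans[OF _ ge[of 0]]) auto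
  have fin: "finite {is :: 'a list. length is \<le> k}"
    using finite_lists_length_le[of "UNIV :: 'a set" k] by simp
  have "?S [] \<le> schwartz_norm k f"
    unfolding schwartz_norm_def by (rule member_le_sum) (auto simp: S0 fin)
  with ge[of x "[]"] show ?thesis by simp
qed

lemma integrable_bounded_times_schwartz:
  fixes u f :: "real ^ 'n::finite \<Rightarrow> complex"
  assumes u: "u \<in> borel_measurable lborel" "\<And>x. cmod (u x) \<le> B" and f: "f \<in> schwartz_space"
  shows "integrable lborel (\<lambda>x. u x * cnj (f x))"
    and "cmod (distribution_of u f) \<le>
      (B * (LINT x|lborel. inverse ((1 + norm (x::real ^ 'n)) ^ (2 * CARD('n))))) * schwartz_norm (2 * CARD('n)) f"
proof -
  let ?w = "\<lambda>x::real ^ 'n. inverse ((1 + norm x) ^ (2 * CARD('n)))"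
  let ?K = "B * schwartz_norm (2 * CARD('n)) f"
  have bd: "norm (u x * cnj (f x)) \<le> ?K * ?w x" for x
  proof -
    have B0: "0 \<le> B" using u(2)[of 0] norm_ge_zero order_trans by blast
    have pos: "0 < (1 + norm x) ^ (2 * CARD('n))"
      by (intro zero_less_power add_pos_nonneg) auto
    have "cmod (f x) \<le> schwartz_norm (2 * CARD('n)) f * ?w x"
      using schwartz_norm_bound[OF f, of x "2 * CARD('n)"] pos
      by (simp add: field_simps)
    then show ?thesis
      using u(2)[of x] B0
      by (simp only: norm_mult complex_mod_cnj mult.assoc) (intro mult_mono, auto)
  qed
  have int: "integrable lborel (\<lambda>x. ?K * ?w x)"
    by (intro integrable_mult_right integrable_weight)
  have m: "(\<lambda>x. u x * cnj (f x)) \<in> borel_measurable lborel"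
    using u(1) schwartz_measurable[OF f]
    by (intro borel_measurable_times measurable_compose[OF schwartz_measurable[OF f]]
          borel_measurable_continuous_onI continuous_intros)
  show i: "integrable lborel (\<lambda>x. u x * cnj (f x))"
    using bd by (intro Bochner_Integration.integrable_bound[OF int m] AE_I2)
      (metis abs_ge_self order_trans real_norm_def)
  have "cmod (distribution_of u f) \<le> (LINT x|lborel. norm (u x * cnj (f x)))"
    unfolding distribution_of_def by (rule integral_norm_bound)
  also have "\<dots> \<le> (LINT x|lborel. ?K * ?w x)"
    using i int bd by (intro integral_mono integrable_norm)
  finally show "cmod (distribution_of u f) \<le> (B * (LINT x|lborel. ?w x)) * schwartz_norm (2 * CARD('n)) f"
    by (simp add: mult_ac)
qed

lemma distribution_of_tempered:
  fixes u :: "real ^ 'n::finite \<Rightarrow> complex"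
  assumes u: "u \<in> borel_measurable lborel" "\<And>x. cmod (u x) \<le> B"
  shows "distribution_of u \<in> tempered_distributions"
proof -
  note int = integrable_bounded_times_schwartz(1)[OF u]
  have "distribution_of u (\<lambda>x. f x + g x) = distribution_of u f + distribution_of u g"
    if "f \<in> schwartz_space" "g \<in> schwartz_space" for f g
    unfolding distribution_of_def
    by (subst Bochner_Integration.integral_add[symmetric])
       (auto simp: int that algebra_simps)
  moreover have "distribution_of u (\<lambda>x. a * f x) = cnj a * distribution_of u f" for a f
    unfolding distribution_of_def
    by (subst integral_mult_right_zero[symmetric]) (simp add: mult_ac)
  moreover have "\<exists>C k. \<forall>f\<in>schwartz_space. cmod (distribution_of u f) \<le> C * schwartz_norm k f"
    using integrable_bounded_times_schwartz(2)[OF u] by blast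
  ultimately show ?thesis unfolding tempered_distributions_def by blast
qed

end

theory Submission
  imports Defs "HOL-Probability.Characteristic_Functions"
begin

text \<open>
  The wave front set is the graph of \<open>\<nabla>\<phi>\<^sub>m\<close> over the nonzero vectors
  (\<open>WFg_of_polynomial_phase\<close>). Up to a unimodular factor and a constant, the short-time Fourier transform of
  \<open>exp (i \<phi>)\<close> at \<open>(l x, l^(m - 1) \<xi>)\<close> is the integral of \<open>exp (i \<Phi>)\<close> against the conjugate window, with phase
  \<open>\<Phi>(y) = \<phi>(l x + y) - l^(m - 1) y \<xi>\<close>. The gradient of \<open>\<Phi>\<close> is
  \<open>l^(m - 1) (\<nabla>\<phi>\<^sub>m(x) - \<xi>)\<close> up to an error of order \<open>l^(m - 2)\<close> that grows polynomially in \<open>y\<close>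
  (\<open>mi_poly_grad_asymptotics\<close>).

  Off the graph the phase is not stationary. Repeated integration by parts in one coordinate direction
  (\<open>oscillatory_integral_decay\<close>) yields decay of any order in \<open>l\<close>, uniformly near the given point, hence
  \<open>not_in_WFg_off_gradient\<close>.

  On the graph the transform cannot decay, because \<open>exp (i \<phi>)\<close> has modulus one near \<open>l x\<close> and its
  local frequencies there all lie near \<open>l^(m - 1) \<nabla>\<phi>\<^sub>m(x)\<close>. This is made precise by a Gaussian average of the transform over
  these frequencies, which recovers the value of \<open>exp (i \<phi>)\<close> times the conjugate window at a single point
  (\<open>gaussian_average_of_STFT\<close>) and would tend to zero if the transform decayed (\<open>in_WFg_on_gradient\<close>).
\<close>

section \<open>Gradients of polynomials under dilation\<close>

text \<open>The exponents of the \<open>i\<close>-th partial derivative of a monomial: \<open>\<partial>\<^sub>i x^\<alpha> = \<alpha>\<^sub>i x^(mi_dec i \<alpha>)\<close>.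
  If \<open>\<alpha> i = 0\<close> nothing is lowered, but then the factor \<open>\<alpha>\<^sub>i\<close> vanishes.\<close>

definition mi_dec :: "'n::finite \<Rightarrow> ('n \<Rightarrow> nat) \<Rightarrow> 'n \<Rightarrow> nat" where
  "mi_dec i \<alpha> = \<alpha>(i := \<alpha> i - 1)"

lemma mi_dec_same [simp]: "mi_dec i \<alpha> i = \<alpha> i - 1"
  by (simp add: mi_dec_def)

lemma mi_order_dec:
  assumes "\<alpha> i \<noteq> 0"
  shows "Suc (mi_order (mi_dec i \<alpha>)) = mi_order \<alpha>"
proof -
  have "mi_order \<alpha> = \<alpha> i + (\<Sum>j\<in>UNIV - {i}. \<alpha> j)"
    unfolding mi_order_def by (subst sum.remove[of _ i]) auto
  moreover have "mi_order (mi_dec i \<alpha>) = (\<alpha> i - 1) + (\<Sum>j\<in>UNIV - {i}. mi_dec i \<alpha> j)"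
    unfolding mi_order_def by (subst sum.remove[of _ i]) (auto simp: mi_dec_def)
  moreover have "(\<Sum>j\<in>UNIV - {i}. mi_dec i \<alpha> j) = (\<Sum>j\<in>UNIV - {i}. \<alpha> j)"
    by (intro sum.cong) (auto simp: mi_dec_def)
  ultimately show ?thesis using assms by simp
qed

lemma mi_power_dec:
  "(\<Prod>j\<in>UNIV - {i}. (x $ j) ^ \<alpha> j) * (x $ i) ^ (\<alpha> i - 1) = mi_power x (mi_dec i \<alpha>)"
proof -
  have "(\<Prod>j\<in>UNIV - {i}. (x $ j) ^ mi_dec i \<alpha> j) = (\<Prod>j\<in>UNIV - {i}. (x $ j) ^ \<alpha> j)"
    by (intro prod.cong) (auto simp: mi_dec_def)
  then show ?thesis
    unfolding mi_power_def by (subst prod.remove[of _ i]) (auto simp: mi_dec_def mult.commute)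
qed

lemma GDERIV_mi_power:
  "GDERIV (\<lambda>x. mi_power x \<alpha>) x :> (\<chi> i. real (\<alpha> i) * mi_power x (mi_dec i \<alpha>))"
proof -
  have "((\<lambda>x. mi_power x \<alpha>) has_derivative
      (\<lambda>h. \<Sum>i\<in>UNIV. (of_nat (\<alpha> i) * (h $ i) * (x $ i) ^ (\<alpha> i - 1)) * (\<Prod>j\<in>UNIV - {i}. (x $ j) ^ \<alpha> j))) (at x)"
    unfolding mi_power_def
    by (intro has_derivative_prod has_derivative_power bounded_linear.has_derivative[OF bounded_linear_vec_nth]
        has_derivative_ident)
  moreover have "(\<lambda>h. \<Sum>i\<in>UNIV. (of_nat (\<alpha> i) * (h $ i) * (x $ i) ^ (\<alpha> i - 1)) * (\<Prod>j\<in>UNIV - {i}. (x $ j) ^ \<alpha> j))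
     = (\<lambda>h. h \<bullet> (\<chi> i. real (\<alpha> i) * mi_power x (mi_dec i \<alpha>)))"
    by (intro ext) (simp add: inner_vec_def mi_power_dec[symmetric] mult_ac)
  ultimately show ?thesis unfolding gderiv_def by simp
qed

definition mi_poly :: "('n::finite \<Rightarrow> nat) set \<Rightarrow> (('n \<Rightarrow> nat) \<Rightarrow> real) \<Rightarrow> real ^ 'n \<Rightarrow> real" where
  "mi_poly A c x = (\<Sum>\<alpha>\<in>A. c \<alpha> * mi_power x \<alpha>)"

definition mi_poly_grad :: "('n::finite \<Rightarrow> nat) set \<Rightarrow> (('n \<Rightarrow> nat) \<Rightarrow> real) \<Rightarrow> real ^ 'n \<Rightarrow> real ^ 'n" where
  "mi_poly_grad A c x = (\<chi> i. \<Sum>\<alpha>\<in>A. c \<alpha> * (real (\<alpha> i) * mi_power x (mi_dec i \<alpha>)))"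

lemma GDERIV_mi_poly: "GDERIV (mi_poly A c) x :> mi_poly_grad A c x"
proof -
  have "((\<lambda>x. \<Sum>\<alpha>\<in>A. c \<alpha> * mi_power x \<alpha>) has_derivative
     (\<lambda>h. \<Sum>\<alpha>\<in>A. c \<alpha> * (h \<bullet> (\<chi> i. real (\<alpha> i) * mi_power x (mi_dec i \<alpha>))))) (at x)"
    by (intro has_derivative_sum has_derivative_mult_right GDERIV_mi_power[unfolded gderiv_def])
  moreover have "(\<lambda>h. \<Sum>\<alpha>\<in>A. c \<alpha> * (h \<bullet> (\<chi> i. real (\<alpha> i) * mi_power x (mi_dec i \<alpha>))))
     = (\<lambda>h. h \<bullet> mi_poly_grad A c x)"
    by (intro ext, simp add: inner_vec_def mi_poly_grad_def sum_distrib_left,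
        subst sum.swap, simp add: mult_ac)
  ultimately show ?thesis
    unfolding gderiv_def mi_poly_def[abs_def] by simp
qed

lemma continuous_mi_power: "continuous_on UNIV (\<lambda>x. mi_power x \<alpha>)"
  unfolding mi_power_def by (intro continuous_intros)

lemma continuous_mi_poly: "continuous_on UNIV (mi_poly A c)"
  unfolding mi_poly_def[abs_def] by (intro continuous_intros continuous_mi_power)

lemma mi_power_le:
  assumes "\<And>i. \<bar>x $ i\<bar> \<le> L"
  shows "\<bar>mi_power x \<alpha>\<bar> \<le> L ^ mi_order \<alpha>"
proof -
  have "\<bar>mi_power x \<alpha>\<bar> = (\<Prod>i\<in>UNIV. \<bar>x $ i\<bar> ^ \<alpha> i)"
    by (simp add: mi_power_def abs_prod power_abs)
  also have "\<dots> \<le> (\<Prod>i\<in>UNIV. L ^ \<alpha> i)"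
    using assms by (intro prod_mono) (auto intro: power_mono)
  finally show ?thesis by (simp add: mi_order_def power_sum)
qed

lemma mi_power_scaleR: "mi_power (r *\<^sub>R x) \<alpha> = r ^ mi_order \<alpha> * mi_power x \<alpha>"
  by (simp add: mi_power_def mi_order_def power_mult_distrib prod.distrib power_sum)

text \<open>After scaling by \<open>1 / L\<close> all coordinates lie between \<open>- 1\<close> and \<open>1\<close>, where a product is a Lipschitz
  function of its factors.\<close>

lemma mi_power_diff_le:
  assumes "\<And>i. \<bar>x $ i\<bar> \<le> L" "\<And>i. \<bar>y $ i\<bar> \<le> L" "\<And>i. \<bar>x $ i - y $ i\<bar> \<le> \<delta>" "L > 0"
  shows "L * \<bar>mi_power x \<alpha> - mi_power y \<alpha>\<bar> \<le> real (mi_order \<alpha>) * L ^ mi_order \<alpha> * \<delta>"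
proof -
  have x1: "\<bar>inverse L * x $ i\<bar> \<le> 1" "\<bar>inverse L * y $ i\<bar> \<le> 1" for i
    using assms by (auto simp: field_simps abs_mult)
  have "\<bar>mi_power (inverse L *\<^sub>R x) \<alpha> - mi_power (inverse L *\<^sub>R y) \<alpha>\<bar>
     \<le> (\<Sum>i\<in>UNIV. \<bar>(inverse L * x $ i) ^ \<alpha> i - (inverse L * y $ i) ^ \<alpha> i\<bar>)"
    unfolding mi_power_def real_norm_def[symmetric] vector_scaleR_component real_scaleR_def
    by (intro norm_prod_diff) (simp_all only: real_norm_def power_abs power_le_one abs_ge_zero x1)
  also have "\<dots> \<le> (\<Sum>i\<in>UNIV. real (\<alpha> i) * \<bar>inverse L * x $ i - inverse L * y $ i\<bar>)"
    using x1 unfolding real_norm_def[symmetric] by (intro sum_mono norm_power_diff) auto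
  also have "\<dots> \<le> (\<Sum>i\<in>UNIV. real (\<alpha> i) * (inverse L * \<delta>))"
  proof (intro sum_mono mult_left_mono)
    fix i
    have "\<bar>inverse L * x $ i - inverse L * y $ i\<bar> = inverse L * \<bar>x $ i - y $ i\<bar>"
      unfolding right_diff_distrib[symmetric] abs_mult using assms(4) by simp
    also have "\<dots> \<le> inverse L * \<delta>" using assms by (intro mult_left_mono) auto
    finally show "\<bar>inverse L * x $ i - inverse L * y $ i\<bar> \<le> inverse L * \<delta>" .
  qed auto
  also have "\<dots> = real (mi_order \<alpha>) * (inverse L * \<delta>)"
    by (simp add: mi_order_def sum_distrib_right)
  finally have "inverse L ^ mi_order \<alpha> * \<bar>mi_power x \<alpha> - mi_power y \<alpha>\<bar> \<le> real (mi_order \<alpha>) * (inverse L * \<delta>)"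
    unfolding mi_power_scaleR right_diff_distrib[symmetric] abs_mult using assms(4) by simp
  then have "(L ^ mi_order \<alpha> * L) * (inverse L ^ mi_order \<alpha> * \<bar>mi_power x \<alpha> - mi_power y \<alpha>\<bar>)
     \<le> (L ^ mi_order \<alpha> * L) * (real (mi_order \<alpha>) * (inverse L * \<delta>))"
    using assms(4) by (intro mult_left_mono) auto
  moreover have "(L ^ mi_order \<alpha> * L) * (inverse L ^ mi_order \<alpha> * d) = L * d" for d
    using assms(4) by (simp add: power_inverse)
  moreover have "(L ^ mi_order \<alpha> * L) * (real (mi_order \<alpha>) * (inverse L * \<delta>)) = real (mi_order \<alpha>) * L ^ mi_order \<alpha> * \<delta>"
    using assms(4) by simp
  ultimately show ?thesis by simp
qed

lemma component_dilate_le: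
  fixes x y :: "real ^ 'n::finite"
  assumes "norm x \<le> R" "1 \<le> l"
  shows "\<bar>(l *\<^sub>R x + y) $ i\<bar> \<le> l * ((1 + R) * (1 + norm y))"
proof -
  have R: "0 \<le> R" using assms norm_ge_zero order_trans by blast
  have "\<bar>(l *\<^sub>R x + y) $ i\<bar> \<le> norm (l *\<^sub>R x + y)" by (rule component_le_norm_cart)
  also have "\<dots> \<le> l * norm x + norm y" using norm_triangle_ineq[of "l *\<^sub>R x" y] assms by simp
  also have "\<dots> \<le> l * R + l * norm y"
    using assms by (intro add_mono mult_left_mono mult_left_mono[of 1 l "norm y", simplified mult_1 mult_1_right])
      (auto simp: mult_le_cancel_right1)
  also have "\<dots> = l * (R + norm y)" by (simp add: algebra_simps)
  also have "\<dots> \<le> l * ((1 + R) * (1 + norm y))"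
    using R assms by (intro mult_left_mono) (auto simp: algebra_simps)
  finally show ?thesis .
qed

lemma mi_power_dilate_bound:
  fixes x y :: "real ^ 'n::finite"
  assumes "norm x \<le> R" "1 \<le> l"
  shows "\<bar>mi_power (l *\<^sub>R x + y) \<alpha>\<bar> \<le> (l * ((1 + R) * (1 + norm y))) ^ mi_order \<alpha>"
  by (intro mi_power_le component_dilate_le assms)

text \<open>Shifting \<open>l x\<close> by \<open>y\<close> changes a monomial by one power of \<open>l\<close> less than its size. This gain is the
  source of every estimate on the phase below.\<close>

lemma mi_power_dilate_diff:
  fixes x y :: "real ^ 'n::finite"
  assumes "norm x \<le> R" "1 \<le> l"
  shows "l * \<bar>mi_power (l *\<^sub>R x + y) \<alpha> - mi_power (l *\<^sub>R x) \<alpha>\<bar>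
    \<le> real (mi_order \<alpha>) * (l * ((1 + R) * (1 + norm y))) ^ mi_order \<alpha>"
proof -
  define W where "W = (1 + R) * (1 + norm y)"
  have R: "0 \<le> R" using assms norm_ge_zero order_trans by blast
  have W: "norm y \<le> W" "0 < W" "(1 + R) * (1 + norm (0 :: real ^ 'n)) \<le> W"
    using R by (auto simp: W_def algebra_simps mult_le_cancel_left1 intro!: mult_pos_pos add_pos_nonneg)
  have "(l * W) * \<bar>mi_power (l *\<^sub>R x + y) \<alpha> - mi_power (l *\<^sub>R x) \<alpha>\<bar>
      \<le> real (mi_order \<alpha>) * (l * W) ^ mi_order \<alpha> * W"
  proof (rule mi_power_diff_le)
    show "\<bar>(l *\<^sub>R x + y) $ i\<bar> \<le> l * W" for i
      unfolding W_def by (rule component_dilate_le[OF assms])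
    show "\<bar>(l *\<^sub>R x) $ i\<bar> \<le> l * W" for i
    proof -
      have "\<bar>(l *\<^sub>R x) $ i\<bar> \<le> l * ((1 + R) * (1 + norm (0 :: real ^ 'n)))"
        using component_dilate_le[OF assms, of 0 i] by simp
      also have "\<dots> \<le> l * W" using W assms by (intro mult_left_mono) auto
      finally show ?thesis .
    qed
    show "\<bar>(l *\<^sub>R x + y) $ i - (l *\<^sub>R x) $ i\<bar> \<le> W" for i
      using component_le_norm_cart[of y i] W by simp
    show "0 < l * W" using assms W by simp
  qed
  then have "W * (l * \<bar>mi_power (l *\<^sub>R x + y) \<alpha> - mi_power (l *\<^sub>R x) \<alpha>\<bar>)
    \<le> W * (real (mi_order \<alpha>) * (l * W) ^ mi_order \<alpha>)" by (simp add: mult_ac)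
  then show ?thesis using W by (simp only: mult_le_cancel_left_pos W_def[symmetric])
qed

text \<open>In the gradient at \<open>l x + y\<close> the monomials of order \<open>m\<close> contribute \<open>l^(m - 1) \<nabla>\<phi>\<^sub>m(x)\<close> up to the
  error of \<open>mi_power_dilate_diff\<close>, and the monomials of lower order are of the size of that
  error. The estimate is multiplied by \<open>l\<close> because the order of
  the error, \<open>l^(m - 2)\<close>, is a negative power when \<open>m = 1\<close>.\<close>

lemma mi_poly_grad_dilate:
  fixes c :: "('n::finite \<Rightarrow> nat) \<Rightarrow> real"
  assumes m: "m \<ge> 1"
  obtains C where "\<And>l x y. norm x \<le> R \<Longrightarrow> 1 \<le> l \<Longrightarrow>
    l * norm (mi_poly_grad {\<alpha>. mi_order \<alpha> \<le> m} c (l *\<^sub>R x + y) - l ^ (m - 1) *\<^sub>R mi_poly_grad {\<alpha>. mi_order \<alpha> = m} c x)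
      \<le> C * l ^ (m - 1) * (1 + norm y) ^ (m - 1)"
proof
  fix l :: real and x y :: "real ^ 'n"
  assume x: "norm x \<le> R" and l: "1 \<le> l"
  have R: "0 \<le> R" using x norm_ge_zero order_trans by blast
  define W where "W = l * ((1 + R) * (1 + norm y))"
  have lW: "l \<le> W" "1 \<le> W"
  proof -
    have "1 * 1 \<le> (1 + R) * (1 + norm y)" using R by (intro mult_mono) auto
    then show "l \<le> W" using l by (simp add: W_def mult_le_cancel_left1)
    then show "1 \<le> W" using l by simp
  qed
  let ?A = "{\<alpha> :: 'n \<Rightarrow> nat. mi_order \<alpha> \<le> m}" and ?E = "{\<alpha> :: 'n \<Rightarrow> nat. mi_order \<alpha> = m}"
    and ?B = "{\<alpha> :: 'n \<Rightarrow> nat. mi_order \<alpha> < m}"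
  have split: "?A = ?E \<union> ?B" "?E \<inter> ?B = {}" by auto
  have comp: "l * \<bar>(mi_poly_grad ?A c (l *\<^sub>R x + y) - l ^ (m - 1) *\<^sub>R mi_poly_grad ?E c x) $ i\<bar>
     \<le> (\<Sum>\<alpha>\<in>?A. \<bar>c \<alpha>\<bar> * (real m * (real m * W ^ (m - 1))))" for i
  proof -
    define a where "a \<alpha> = real (\<alpha> i) * (mi_power (l *\<^sub>R x + y) (mi_dec i \<alpha>) -
        (if mi_order \<alpha> = m then l ^ (m - 1) * mi_power x (mi_dec i \<alpha>) else 0))" for \<alpha> :: "'n \<Rightarrow> nat"
    have "(mi_poly_grad ?A c (l *\<^sub>R x + y) - l ^ (m - 1) *\<^sub>R mi_poly_grad ?E c x) $ i
        = (\<Sum>\<alpha>\<in>?A. c \<alpha> * a \<alpha>)"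
    proof -
      have "(\<Sum>\<alpha>\<in>?E. c \<alpha> * (real (\<alpha> i) * mi_power x (mi_dec i \<alpha>)))
         = (\<Sum>\<alpha>\<in>?A. if mi_order \<alpha> = m then c \<alpha> * (real (\<alpha> i) * mi_power x (mi_dec i \<alpha>)) else 0)"
        by (rule sum.mono_neutral_cong_left) (auto simp: finite_mi_order_le)
      then show ?thesis
        by (simp add: mi_poly_grad_def a_def sum_distrib_left sum_subtractf[symmetric])
          (auto intro!: sum.cong simp: algebra_simps)
    qed
    then have "l * \<bar>(mi_poly_grad ?A c (l *\<^sub>R x + y) - l ^ (m - 1) *\<^sub>R mi_poly_grad ?E c x) $ i\<bar>
       \<le> l * (\<Sum>\<alpha>\<in>?A. \<bar>c \<alpha> * a \<alpha>\<bar>)" using l by (auto intro!: mult_left_mono)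
    also have "\<dots> = (\<Sum>\<alpha>\<in>?A. \<bar>c \<alpha>\<bar> * (l * \<bar>a \<alpha>\<bar>))"
      by (simp add: sum_distrib_left abs_mult mult_ac)
    also have "\<dots> \<le> (\<Sum>\<alpha>\<in>?A. \<bar>c \<alpha>\<bar> * (real m * (real m * W ^ (m - 1))))"
    proof (intro sum_mono mult_left_mono)
      fix \<alpha> :: "'n \<Rightarrow> nat" assume \<alpha>: "\<alpha> \<in> ?A"
      show "l * \<bar>a \<alpha>\<bar> \<le> real m * (real m * W ^ (m - 1))"
      proof (cases "\<alpha> i = 0")
        case False
        note ord = mi_order_dec[of \<alpha> i, OF False]
        have "\<alpha> i \<le> mi_order \<alpha>" unfolding mi_order_def by (rule member_le_sum) auto
        then have \<alpha>m: "real (\<alpha> i) \<le> real m" using \<alpha> by simp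
        have "l * \<bar>mi_power (l *\<^sub>R x + y) (mi_dec i \<alpha>) -
          (if mi_order \<alpha> = m then l ^ (m - 1) * mi_power x (mi_dec i \<alpha>) else 0)\<bar> \<le> real m * W ^ (m - 1)"
        proof (cases "mi_order \<alpha> = m")
          case True
          with ord have o: "mi_order (mi_dec i \<alpha>) = m - 1" by simp
          have "l * \<bar>mi_power (l *\<^sub>R x + y) (mi_dec i \<alpha>) - mi_power (l *\<^sub>R x) (mi_dec i \<alpha>)\<bar>
            \<le> real (m - 1) * W ^ (m - 1)"
            using mi_power_dilate_diff[OF x l, of y "mi_dec i \<alpha>"] by (simp add: o W_def)
          also have "\<dots> \<le> real m * W ^ (m - 1)" using lW by (intro mult_right_mono) auto
          finally show ?thesis using True by (simp add: mi_power_scaleR o)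
        next
          case False
          with \<alpha> ord have o: "Suc (mi_order (mi_dec i \<alpha>)) \<le> m - 1" by simp
          have "l * \<bar>mi_power (l *\<^sub>R x + y) (mi_dec i \<alpha>)\<bar> \<le> W * W ^ mi_order (mi_dec i \<alpha>)"
            using lW l mi_power_dilate_bound[OF x l, of y "mi_dec i \<alpha>"]
            by (intro mult_mono) (auto simp: W_def)
          also have "\<dots> \<le> W ^ (m - 1)"
            using power_increasing[OF o lW(2)] by simp
          also have "\<dots> \<le> real m * W ^ (m - 1)" using lW m by simp
          finally show ?thesis using False by simp
        qed
        then have "real (\<alpha> i) * (l * \<bar>mi_power (l *\<^sub>R x + y) (mi_dec i \<alpha>) -
          (if mi_order \<alpha> = m then l ^ (m - 1) * mi_power x (mi_dec i \<alpha>) else 0)\<bar>) \<le> real m * (real m * W ^ (m - 1))"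
          by (rule mult_mono[OF \<alpha>m]) (use l in auto)
        then show ?thesis by (simp add: a_def abs_mult mult_ac)
      qed (use lW in \<open>auto simp: a_def\<close>)
    qed auto
    finally show ?thesis .
  qed
  let ?S = "(\<Sum>\<alpha>\<in>?A. \<bar>c \<alpha>\<bar> * (real m * (real m * W ^ (m - 1))))"
  have "l * norm (mi_poly_grad ?A c (l *\<^sub>R x + y) - l ^ (m - 1) *\<^sub>R mi_poly_grad ?E c x)
    \<le> l * (\<Sum>i\<in>UNIV. \<bar>(mi_poly_grad ?A c (l *\<^sub>R x + y) - l ^ (m - 1) *\<^sub>R mi_poly_grad ?E c x) $ i\<bar>)"
    using l by (intro mult_left_mono norm_le_l1_cart) auto
  also have "\<dots> \<le> (\<Sum>i\<in>(UNIV :: 'n set). ?S)"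
    unfolding sum_distrib_left by (intro sum_mono comp)
  also have "\<dots> = (real CARD('n) * (\<Sum>\<alpha>\<in>?A. \<bar>c \<alpha>\<bar> * (real m * (real m * (1 + R) ^ (m - 1))))) * l ^ (m - 1) * (1 + norm y) ^ (m - 1)"
    by (simp add: W_def power_mult_distrib sum_distrib_left sum_distrib_right mult_ac)
  finally show "l * norm (mi_poly_grad ?A c (l *\<^sub>R x + y) - l ^ (m - 1) *\<^sub>R mi_poly_grad ?E c x)
    \<le> (real CARD('n) * (\<Sum>\<alpha>\<in>?A. \<bar>c \<alpha>\<bar> * (real m * (real m * (1 + R) ^ (m - 1))))) * l ^ (m - 1) * (1 + norm y) ^ (m - 1)" .
qed

text \<open>To leading order the gradient of the phase near \<open>l x\<close> is \<open>l^(m - 1) \<nabla>\<phi>\<^sub>m(x)\<close>. The exponent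
  \<open>s = m - 1\<close> of the wave front set is this homogeneity degree. The error is smaller by a factor \<open>l\<close>
  and grows polynomially in \<open>y\<close>, which the rapid decay of the window absorbs.\<close>

corollary mi_poly_grad_asymptotics:
  fixes c :: "('n::finite \<Rightarrow> nat) \<Rightarrow> real"
  assumes m: "m \<ge> 2"
  obtains C where "0 \<le> C" "\<And>l x y. norm x \<le> R \<Longrightarrow> 1 \<le> l \<Longrightarrow>
    norm (mi_poly_grad {\<alpha>. mi_order \<alpha> \<le> m} c (l *\<^sub>R x + y) - l ^ (m - 1) *\<^sub>R mi_poly_grad {\<alpha>. mi_order \<alpha> = m} c x)
      \<le> C * l ^ (m - 2) * (1 + norm y) ^ (m - 1)"
proof -
  have "1 \<le> m" using m by simp
  from mi_poly_grad_dilate[OF this, of R c] obtain C where C: "\<And>l x y. norm x \<le> R \<Longrightarrow> 1 \<le> l \<Longrightarrow>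
    l * norm (mi_poly_grad {\<alpha>. mi_order \<alpha> \<le> m} c (l *\<^sub>R x + y) - l ^ (m - 1) *\<^sub>R mi_poly_grad {\<alpha>. mi_order \<alpha> = m} c x)
      \<le> C * l ^ (m - 1) * (1 + norm y) ^ (m - 1)" by blast
  have "norm (mi_poly_grad {\<alpha>. mi_order \<alpha> \<le> m} c (l *\<^sub>R x + y) - l ^ (m - 1) *\<^sub>R mi_poly_grad {\<alpha>. mi_order \<alpha> = m} c x)
      \<le> \<bar>C\<bar> * l ^ (m - 2) * (1 + norm y) ^ (m - 1)" if x: "norm x \<le> R" and l: "1 \<le> l" for l :: real and x y :: "real ^ 'n"
  proof -
    have "m - 1 = Suc (m - 2)" using m by simp
    then have lm: "l ^ (m - 1) = l * l ^ (m - 2)" by (simp only: power_Suc)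
    have "C * l ^ (m - 1) * (1 + norm y) ^ (m - 1) \<le> \<bar>C\<bar> * l ^ (m - 1) * (1 + norm y) ^ (m - 1)"
      using l by (intro mult_right_mono) auto
    also have "\<dots> = l * (\<bar>C\<bar> * l ^ (m - 2) * (1 + norm y) ^ (m - 1))"
      by (simp only: lm mult_ac)
    finally have "l * norm (mi_poly_grad {\<alpha>. mi_order \<alpha> \<le> m} c (l *\<^sub>R x + y) - l ^ (m - 1) *\<^sub>R mi_poly_grad {\<alpha>. mi_order \<alpha> = m} c x)
      \<le> l * (\<bar>C\<bar> * l ^ (m - 2) * (1 + norm y) ^ (m - 1))"
      using C[OF x l, of y] by linarith
    then show ?thesis using l by (simp only: mult_le_cancel_left_pos)
  qed
  then show ?thesis using that[of "\<bar>C\<bar>"] by simp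
qed

lemma continuous_mi_poly_grad: "continuous_on UNIV (mi_poly_grad A c)"
  unfolding mi_poly_grad_def[abs_def]
  by (intro continuous_on_vec_lambda continuous_intros continuous_mi_power)

lemma GDERIV_along:
  assumes "GDERIV f x :> D"
  shows "((\<lambda>s. f (x + s *\<^sub>R v)) has_real_derivative v \<bullet> D) (at 0)"
proof -
  have "((\<lambda>s. x + s *\<^sub>R v) has_derivative (\<lambda>s. s *\<^sub>R v)) (at 0)"
    by (auto intro!: derivative_eq_intros)
  moreover have "(f has_derivative (\<lambda>h. h \<bullet> D)) (at (x + 0 *\<^sub>R v))"
    using assms by (simp add: gderiv_def)
  ultimately have "((\<lambda>s. f (x + s *\<^sub>R v)) has_derivative (\<lambda>s. s *\<^sub>R v \<bullet> D)) (at 0)"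
    by (rule has_derivative_compose)
  then show ?thesis
    by (simp add: has_field_derivative_def mult_commute_abs)
qed

section \<open>Integrals over Euclidean space\<close>

lemma lborel_integral_affine:
  fixes f :: "'a::euclidean_space \<Rightarrow> 'b::{banach, second_countable_topology}"
  assumes [measurable]: "f \<in> borel_measurable borel" and "c \<noteq> 0"
  shows "(LINT x|lborel. f x) = \<bar>c\<bar> ^ DIM('a) *\<^sub>R (LINT x|lborel. f (t + c *\<^sub>R x))"
  by (subst lborel_affine[OF assms(2), of t])
    (simp add: integral_density integral_distr)

lemma integrable_lborel_translate:
  fixes f :: "'a::euclidean_space \<Rightarrow> 'b::{banach, second_countable_topology}"
  assumes "integrable lborel f"
  shows "integrable lborel (\<lambda>x. f (t + x))"
proof -
  have "integrable (distr lborel borel ((+) t)) f"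
    unfolding lborel_distr_plus by (rule assms)
  then show ?thesis by (rule integrable_distr[rotated]) simp
qed

lemma integrable_rapid:
  fixes F :: "real ^ 'n::finite \<Rightarrow> complex"
  assumes "continuous_on UNIV F" and "\<And>y. (1 + norm y) ^ (2 * CARD('n)) * cmod (F y) \<le> C"
  shows "integrable lborel F"
    and "cmod (LINT y|lborel. F y) \<le> C * (LINT y|lborel. inverse ((1 + norm (y::real ^ 'n)) ^ (2 * CARD('n))))"
proof -
  let ?w = "\<lambda>y::real ^ 'n. inverse ((1 + norm y) ^ (2 * CARD('n)))"
  have bd: "norm (F y) \<le> C * ?w y" for y
  proof -
    have "0 < (1 + norm y) ^ (2 * CARD('n))"
      by (intro zero_less_power add_pos_nonneg) auto
    then show ?thesis using assms(2)[of y] by (simp add: field_simps)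
  qed
  have int: "integrable lborel (\<lambda>y. C * ?w y)"
    by (intro integrable_mult_right integrable_weight)
  have m: "F \<in> borel_measurable lborel"
    using assms(1) by (simp add: borel_measurable_continuous_onI)
  show i: "integrable lborel F"
    using bd by (intro Bochner_Integration.integrable_bound[OF int m] AE_I2)
      (metis abs_ge_self order_trans real_norm_def)
  have "cmod (LINT y|lborel. F y) \<le> (LINT y|lborel. norm (F y))"
    by (rule integral_norm_bound)
  also have "\<dots> \<le> (LINT y|lborel. C * ?w y)"
    using i int bd by (intro integral_mono integrable_norm)
  finally show "cmod (LINT y|lborel. F y) \<le> C * (LINT y|lborel. ?w y)" by simp
qed

lemma directional_has_vector_derivative:
  fixes F :: "'a::real_normed_vector \<Rightarrow> 'b::real_normed_vector"
  assumes "\<And>y. ((\<lambda>s. F (y + s *\<^sub>R e)) has_vector_derivative F' y) (at 0)"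
  shows "((\<lambda>s. F (y + s *\<^sub>R e)) has_vector_derivative F' (y + s *\<^sub>R e)) (at s)"
proof -
  have "((\<lambda>r. r - s) has_vector_derivative 1) (at s)"
    by (auto intro!: derivative_eq_intros)
  moreover have "((\<lambda>r. F ((y + s *\<^sub>R e) + r *\<^sub>R e)) has_vector_derivative F' (y + s *\<^sub>R e)) (at (s - s))"
    using assms[of "y + s *\<^sub>R e"] by simp
  ultimately show ?thesis
    using vector_diff_chain_at[of "\<lambda>r. r - s" 1 s "\<lambda>r. F ((y + s *\<^sub>R e) + r *\<^sub>R e)"]
    by (simp add: o_def algebra_simps)
qed

text \<open>The integral of a difference quotient of \<open>F\<close> vanishes because Lebesgue measure is translation
  invariant, and the mean value theorem gives an integrable majorant for the limit. This avoids
  splitting the integral into coordinates.\<close>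

lemma integral_directional_derivative_eq_0:
  fixes F :: "real ^ 'n::finite \<Rightarrow> complex"
  assumes F: "continuous_on UNIV F" "\<And>y. (1 + norm y) ^ (2 * CARD('n)) * cmod (F y) \<le> C"
    and F': "continuous_on UNIV F'" "\<And>y. (1 + norm y) ^ (2 * CARD('n)) * cmod (F' y) \<le> C'"
    and deriv: "\<And>y. ((\<lambda>s. F (y + s *\<^sub>R e)) has_vector_derivative F' y) (at 0)"
  shows "(LINT y|lborel. F' y) = 0"
proof -
  let ?d = "2 * CARD('n)"
  define s :: "nat \<Rightarrow> real" where "s j = inverse (real (Suc j))" for j
  have s: "0 < s j" "s j \<le> 1" for j by (auto simp: s_def field_simps)
  have s0: "s \<longlonglongrightarrow> 0" unfolding s_def by (rule LIMSEQ_inverse_real_of_nat)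
  define q where "q j y = (F (y + s j *\<^sub>R e) - F y) /\<^sub>R s j" for j y
  let ?D = "(1 + norm e) ^ ?d * C'"
  have bd: "norm (q j y) \<le> ?D * inverse ((1 + norm y) ^ ?d)" for j y
  proof -
    have pos: "0 < (1 + norm z) ^ ?d" for z :: "real ^ 'n"
      by (intro zero_less_power add_pos_nonneg) auto
    have F'b: "norm (F' (y + r *\<^sub>R e)) \<le> ?D * inverse ((1 + norm y) ^ ?d)" if "0 \<le> r" "r \<le> 1" for r
    proof -
      have "norm y \<le> norm (y + r *\<^sub>R e) + norm (r *\<^sub>R e)"
        using norm_triangle_ineq4[of "y + r *\<^sub>R e" "r *\<^sub>R e"] by simp
      also have "\<dots> \<le> norm (y + r *\<^sub>R e) + norm e"
        using that by (auto simp: mult_left_le_one_le)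
      also have "1 + \<dots> \<le> (1 + norm e) * (1 + norm (y + r *\<^sub>R e))"
        by (simp add: algebra_simps)
      finally have "(1 + norm y) ^ ?d \<le> (1 + norm e) ^ ?d * (1 + norm (y + r *\<^sub>R e)) ^ ?d"
        unfolding power_mult_distrib[symmetric] by (intro power_mono) auto
      then have "(1 + norm y) ^ ?d * norm (F' (y + r *\<^sub>R e))
         \<le> (1 + norm e) ^ ?d * ((1 + norm (y + r *\<^sub>R e)) ^ ?d * norm (F' (y + r *\<^sub>R e)))"
        unfolding mult.assoc[symmetric] by (intro mult_right_mono) auto
      also have "\<dots> \<le> ?D" by (intro mult_left_mono F') auto
      finally show ?thesis using pos[of y] by (simp add: field_simps)
    qed
    have "norm (F (y + s j *\<^sub>R e) - F (y + 0 *\<^sub>R e)) \<le> (?D * inverse ((1 + norm y) ^ ?d)) * norm (s j - 0)"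
    proof (rule differentiable_bound[where S="{0..1}" and f' = "\<lambda>r h. h *\<^sub>R F' (y + r *\<^sub>R e)"])
      fix r :: real assume "r \<in> {0..1}"
      then show "onorm (\<lambda>h. h *\<^sub>R F' (y + r *\<^sub>R e)) \<le> ?D * inverse ((1 + norm y) ^ ?d)"
        using F'b[of r] by (intro onorm_le) (simp add: mult.commute[of _ "norm _"] mult_right_mono)
      show "((\<lambda>a. F (y + a *\<^sub>R e)) has_derivative (\<lambda>h. h *\<^sub>R F' (y + r *\<^sub>R e))) (at r within {0..1})"
        using directional_has_vector_derivative[OF deriv, of y r]
        unfolding has_vector_derivative_def by (rule has_derivative_at_withinI)
    qed (use s[of j] in auto)
    then have "norm (F (y + s j *\<^sub>R e) - F y) / s j \<le> ?D * inverse ((1 + norm y) ^ ?d)"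
      using s[of j] by (simp only: pos_divide_le_eq scaleR_zero_left add_0_right diff_0_right real_norm_def abs_of_pos)
    then show ?thesis using s[of j] by (simp add: q_def divide_inverse_commute)
  qed
  have "(\<lambda>j. LINT y|lborel. q j y) \<longlonglongrightarrow> (LINT y|lborel. F' y)"
  proof (rule integral_dominated_convergence)
    show "F' \<in> borel_measurable lborel"
      using F' by (simp add: borel_measurable_continuous_onI)
    show "q j \<in> borel_measurable lborel" for j
      unfolding q_def using F(1)
      by (auto intro!: borel_measurable_continuous_onI continuous_intros
          continuous_on_compose2[of UNIV F])
    show "integrable lborel (\<lambda>y::real ^ 'n. ?D * inverse ((1 + norm y) ^ ?d))"
      by (intro integrable_mult_right integrable_weight)
    show "AE y in lborel. (\<lambda>j. q j y) \<longlonglongrightarrow> F' y"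
    proof (rule AE_I2)
      fix y
      have "((\<lambda>r. (F (y + r *\<^sub>R e) - F y - r *\<^sub>R F' y) /\<^sub>R norm r) \<longlongrightarrow> 0) (at 0)"
        using deriv[of y] unfolding has_vector_derivative_def has_derivative_def by simp
      moreover have "filterlim s (at 0) sequentially"
        unfolding filterlim_at
      proof
        show "\<forall>\<^sub>F j in sequentially. s j \<in> UNIV \<and> s j \<noteq> 0"
          using s(1) by (intro always_eventually) (metis less_irrefl UNIV_I)
      qed (rule s0)
      ultimately have "(\<lambda>j. (F (y + s j *\<^sub>R e) - F y - s j *\<^sub>R F' y) /\<^sub>R norm (s j)) \<longlonglongrightarrow> 0"
        by (rule filterlim_compose)
      moreover have "(F (y + s j *\<^sub>R e) - F y - s j *\<^sub>R F' y) /\<^sub>R norm (s j) = q j y - F' y" for j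
        using s(1)[of j] by (simp add: q_def scaleR_right_diff_distrib)
      ultimately show "(\<lambda>j. q j y) \<longlonglongrightarrow> F' y"
        by (simp add: LIM_zero_iff)
    qed
    show "AE y in lborel. norm (q j y) \<le> ?D * inverse ((1 + norm y) ^ ?d)" for j
      using bd by auto
  qed
  moreover have "(LINT y|lborel. q j y) = 0" for j
  proof -
    have F_int: "integrable lborel F" by (rule integrable_rapid[OF F])
    have "(LINT y|lborel. F (y + s j *\<^sub>R e)) = (LINT y|lborel. F y)"
      using lborel_integral_affine[of F 1 "s j *\<^sub>R e"] F(1)
      by (simp add: borel_measurable_continuous_onI add.commute)
    then show ?thesis
      unfolding q_def using F_int integrable_lborel_translate[OF F_int, of "s j *\<^sub>R e"]
      by (simp add: add.commute)
  qed
  ultimately show ?thesis using LIMSEQ_unique[OF _ tendsto_const[of 0]] by fastforce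
qed

section \<open>Non-stationary phase along one direction\<close>

text \<open>Integrands depend on a parameter \<open>t\<close> in a set \<open>T\<close> (position, frequency and dilation), and all bounds
  are uniform in \<open>t\<close> up to powers of the large parameter \<open>l t\<close>. Integration by parts is carried
  out in the single direction \<open>e\<close>, so only derivatives along \<open>e\<close> are controlled.\<close>

locale phase_family =
  fixes T :: "'t set" and l :: "'t \<Rightarrow> real" and e :: "real ^ 'n::finite"
  assumes l_ge_1: "t \<in> T \<Longrightarrow> 1 \<le> l t"
begin

definition directional_derivative where
  "directional_derivative b b' \<longleftrightarrow>
    (\<forall>t\<in>T. \<forall>y. ((\<lambda>s. b t (y + s *\<^sub>R e)) has_vector_derivative (b' t y :: complex)) (at 0))"

text \<open>The analogue of a symbol class of order \<open>a\<close> in the parameter \<open>l\<close>: polynomial growth in the space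
  variable is harmless since the functions are finally multiplied by a rapidly decaying one.\<close>

definition symb :: "real \<Rightarrow> ('t \<Rightarrow> real ^ 'n \<Rightarrow> complex) \<Rightarrow> bool" where
  "symb a b \<longleftrightarrow> (\<forall>t\<in>T. continuous_on UNIV (b t)) \<and>
     (\<exists>C K. \<forall>t\<in>T. \<forall>y. cmod (b t y) \<le> C * l t powr a * (1 + norm y) ^ K)"

definition rapid :: "real \<Rightarrow> ('t \<Rightarrow> real ^ 'n \<Rightarrow> complex) \<Rightarrow> bool" where
  "rapid a f \<longleftrightarrow> (\<forall>t\<in>T. continuous_on UNIV (f t)) \<and>
     (\<forall>K. \<exists>C. \<forall>t\<in>T. \<forall>y. (1 + norm y) ^ K * cmod (f t y) \<le> C * l t powr a)"

text \<open>\<open>along P n b\<close>: the family \<open>b\<close> and its first \<open>n\<close> derivatives along \<open>e\<close> satisfy \<open>P\<close>. With this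
  recursion an induction over \<open>n\<close> only ever differentiates once, so that no Leibniz formula for higher
  derivatives is involved.\<close>

primrec along :: "(('t \<Rightarrow> real ^ 'n \<Rightarrow> complex) \<Rightarrow> bool) \<Rightarrow> nat \<Rightarrow> ('t \<Rightarrow> real ^ 'n \<Rightarrow> complex) \<Rightarrow> bool" where
  "along P 0 b \<longleftrightarrow> P b"
| "along P (Suc n) b \<longleftrightarrow> P b \<and> (\<exists>b'. directional_derivative b b' \<and> along P n b')"

lemma along_base: "along P n b \<Longrightarrow> P b"
  by (cases n) auto

lemma along_SucD: "along P (Suc n) b \<Longrightarrow> along P n b"
  by (induction n arbitrary: b) auto

lemma along_mono: "(\<And>b. P b \<Longrightarrow> Q b) \<Longrightarrow> along P n b \<Longrightarrow> along Q n b"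
  by (induction n arbitrary: b) auto

lemma along_add:
  assumes "\<And>b c. P b \<Longrightarrow> P c \<Longrightarrow> P (\<lambda>t y. b t y + c t y)"
  shows "along P n b \<Longrightarrow> along P n c \<Longrightarrow> along P n (\<lambda>t y. b t y + c t y)"
proof (induction n arbitrary: b c)
  case (Suc n)
  then obtain b' c' where b': "directional_derivative b b'" "along P n b'"
    and c': "directional_derivative c c'" "along P n c'" by auto
  then have "directional_derivative (\<lambda>t y. b t y + c t y) (\<lambda>t y. b' t y + c' t y)"
    by (auto simp: directional_derivative_def intro!: has_vector_derivative_add)
  moreover have "P (\<lambda>t y. b t y + c t y)"
    by (rule assms; rule along_base) (fact Suc.prems)+
  moreover have "along P n (\<lambda>t y. b' t y + c' t y)"
    by (rule Suc.IH[OF b'(2) c'(2)])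
  ultimately show ?case unfolding along.simps by blast
qed (simp only: along.simps assms)

lemma along_mult:
  assumes "\<And>b c. P b \<Longrightarrow> Q c \<Longrightarrow> R (\<lambda>t y. b t y * c t y)"
    and add: "\<And>b c. R b \<Longrightarrow> R c \<Longrightarrow> R (\<lambda>t y. b t y + c t y)"
  shows "along P n b \<Longrightarrow> along Q n c \<Longrightarrow> along R n (\<lambda>t y. b t y * c t y)"
proof (induction n arbitrary: b c)
  case (Suc n)
  then obtain b' c' where b': "directional_derivative b b'" "along P n b'"
    and c': "directional_derivative c c'" "along Q n c'" by auto
  from b' c' have "directional_derivative (\<lambda>t y. b t y * c t y) (\<lambda>t y. b t y * c' t y + b' t y * c t y)"
    unfolding directional_derivative_def
  proof (intro ballI allI)
    fix t y assume t: "t \<in> T"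
    with b' c' have "((\<lambda>s. b t (y + s *\<^sub>R e)) has_vector_derivative b' t y) (at 0)"
      "((\<lambda>s. c t (y + s *\<^sub>R e)) has_vector_derivative c' t y) (at 0)"
      by (auto simp: directional_derivative_def)
    from has_vector_derivative_mult[OF this]
    show "((\<lambda>s. b t (y + s *\<^sub>R e) * c t (y + s *\<^sub>R e)) has_vector_derivative b t y * c' t y + b' t y * c t y) (at 0)"
      by simp
  qed
  moreover have "along R n (\<lambda>t y. b t y * c' t y + b' t y * c t y)"
    by (rule along_add[OF add Suc.IH[OF along_SucD[OF Suc.prems(1)] c'(2)] Suc.IH[OF b'(2) along_SucD[OF Suc.prems(2)]]])
  moreover have "R (\<lambda>t y. b t y * c t y)"
    by (rule assms(1)[OF along_base[OF Suc.prems(1)] along_base[OF Suc.prems(2)]])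
  ultimately show ?case unfolding along.simps by blast
qed (simp only: along.simps assms)

lemma powr_l_pos: "t \<in> T \<Longrightarrow> 0 < l t powr a"
  using l_ge_1[of t] by simp

lemma symbE:
  assumes "symb a b"
  obtains C K where "0 \<le> C" "\<And>t y. t \<in> T \<Longrightarrow> cmod (b t y) \<le> C * l t powr a * (1 + norm y) ^ K"
proof -
  from assms obtain C K where *: "\<And>t y. t \<in> T \<Longrightarrow> cmod (b t y) \<le> C * l t powr a * (1 + norm y) ^ K"
    unfolding symb_def by blast
  have "cmod (b t y) \<le> \<bar>C\<bar> * l t powr a * (1 + norm y) ^ K" if "t \<in> T" for t y
    using *[OF that, of y] by (rule order_trans) (auto intro!: mult_right_mono)
  then show ?thesis using that[of "\<bar>C\<bar>" K] by auto
qed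

lemma rapidE:
  assumes "rapid a f"
  obtains C where "0 \<le> C" "\<And>t y. t \<in> T \<Longrightarrow> (1 + norm y) ^ K * cmod (f t y) \<le> C * l t powr a"
proof -
  from assms obtain C where *: "\<And>t y. t \<in> T \<Longrightarrow> (1 + norm y) ^ K * cmod (f t y) \<le> C * l t powr a"
    unfolding rapid_def by blast
  have "(1 + norm y) ^ K * cmod (f t y) \<le> \<bar>C\<bar> * l t powr a" if "t \<in> T" for t y
    using *[OF that, of y] by (rule order_trans) (auto intro!: mult_right_mono)
  then show ?thesis using that[of "\<bar>C\<bar>"] by auto
qed

lemma symb_mono:
  assumes "symb a b" "a \<le> a'"
  shows "symb a' b"
proof -
  obtain C K where C: "0 \<le> C" "\<And>t y. t \<in> T \<Longrightarrow> cmod (b t y) \<le> C * l t powr a * (1 + norm y) ^ K"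
    using symbE[OF assms(1)] by blast
  have "cmod (b t y) \<le> C * l t powr a' * (1 + norm y) ^ K" if "t \<in> T" for t y
    using C(2)[OF that, of y] by (rule order_trans)
      (use C(1) assms(2) l_ge_1[OF that] in \<open>auto intro!: mult_right_mono mult_left_mono powr_mono\<close>)
  then show ?thesis using assms(1) unfolding symb_def by blast
qed

lemma symb_add:
  assumes "symb a b" "symb a c"
  shows "symb a (\<lambda>t y. b t y + c t y)"
proof -
  obtain C K where C: "0 \<le> C" "\<And>t y. t \<in> T \<Longrightarrow> cmod (b t y) \<le> C * l t powr a * (1 + norm y) ^ K"
    using symbE[OF assms(1)] by blast
  obtain D L where D: "0 \<le> D" "\<And>t y. t \<in> T \<Longrightarrow> cmod (c t y) \<le> D * l t powr a * (1 + norm y) ^ L"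
    using symbE[OF assms(2)] by blast
  have "cmod (b t y + c t y) \<le> (C + D) * l t powr a * (1 + norm y) ^ (max K L)" if t: "t \<in> T" for t y
  proof -
    have "cmod (b t y) \<le> C * l t powr a * (1 + norm y) ^ (max K L)"
      using C(2)[OF t, of y] by (rule order_trans) (use C(1) in \<open>auto intro!: mult_left_mono power_increasing\<close>)
    moreover have "cmod (c t y) \<le> D * l t powr a * (1 + norm y) ^ (max K L)"
      using D(2)[OF t, of y] by (rule order_trans) (use D(1) in \<open>auto intro!: mult_left_mono power_increasing\<close>)
    ultimately show ?thesis
      using norm_triangle_ineq[of "b t y" "c t y"] by (simp add: algebra_simps)
  qed
  then show ?thesis using assms unfolding symb_def by (auto intro!: continuous_intros)
qed

lemma symb_mult:
  assumes "symb a b" "symb a' c"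
  shows "symb (a + a') (\<lambda>t y. b t y * c t y)"
proof -
  obtain C K where C: "0 \<le> C" "\<And>t y. t \<in> T \<Longrightarrow> cmod (b t y) \<le> C * l t powr a * (1 + norm y) ^ K"
    using symbE[OF assms(1)] by blast
  obtain D L where D: "0 \<le> D" "\<And>t y. t \<in> T \<Longrightarrow> cmod (c t y) \<le> D * l t powr a' * (1 + norm y) ^ L"
    using symbE[OF assms(2)] by blast
  have "cmod (b t y * c t y) \<le> (C * D) * l t powr (a + a') * (1 + norm y) ^ (K + L)" if t: "t \<in> T" for t y
  proof -
    have "cmod (b t y * c t y) \<le> (C * l t powr a * (1 + norm y) ^ K) * (D * l t powr a' * (1 + norm y) ^ L)"
      unfolding norm_mult using C(1) by (intro mult_mono C(2) D(2) t) auto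
    then show ?thesis by (simp add: powr_add power_add mult_ac)
  qed
  then show ?thesis using assms unfolding symb_def by (auto intro!: continuous_intros)
qed

lemma rapid_add:
  assumes "rapid a b" "rapid a c"
  shows "rapid a (\<lambda>t y. b t y + c t y)"
proof -
  have "\<exists>C. \<forall>t\<in>T. \<forall>y. (1 + norm y) ^ K * cmod (b t y + c t y) \<le> C * l t powr a" for K
  proof -
    obtain C where C: "\<And>t y. t \<in> T \<Longrightarrow> (1 + norm y) ^ K * cmod (b t y) \<le> C * l t powr a"
      using rapidE[OF assms(1)] by blast
    obtain D where D: "\<And>t y. t \<in> T \<Longrightarrow> (1 + norm y) ^ K * cmod (c t y) \<le> D * l t powr a"
      using rapidE[OF assms(2)] by blast
    have "(1 + norm y) ^ K * cmod (b t y + c t y) \<le> (C + D) * l t powr a" if t: "t \<in> T" for t y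
    proof -
      have "(1 + norm y) ^ K * cmod (b t y + c t y) \<le> (1 + norm y) ^ K * (cmod (b t y) + cmod (c t y))"
        by (intro mult_left_mono norm_triangle_ineq) auto
      then show ?thesis using C[OF t, of y] D[OF t, of y] by (simp add: algebra_simps)
    qed
    then show ?thesis by blast
  qed
  then show ?thesis using assms unfolding rapid_def by (auto intro!: continuous_intros)
qed

lemma rapid_mult_symb:
  assumes "rapid a f" "symb a' b"
  shows "rapid (a + a') (\<lambda>t y. f t y * b t y)"
proof -
  obtain D L where D: "0 \<le> D" "\<And>t y. t \<in> T \<Longrightarrow> cmod (b t y) \<le> D * l t powr a' * (1 + norm y) ^ L"
    using symbE[OF assms(2)] by blast
  have "\<exists>C. \<forall>t\<in>T. \<forall>y. (1 + norm y) ^ K * cmod (f t y * b t y) \<le> C * l t powr (a + a')" for K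
  proof -
    obtain C where C: "0 \<le> C" "\<And>t y. t \<in> T \<Longrightarrow> (1 + norm y) ^ (K + L) * cmod (f t y) \<le> C * l t powr a"
      using rapidE[OF assms(1)] by blast
    have "(1 + norm y) ^ K * cmod (f t y * b t y) \<le> (C * D) * l t powr (a + a')" if t: "t \<in> T" for t y
    proof -
      have "(1 + norm y) ^ K * cmod (f t y * b t y)
         \<le> (1 + norm y) ^ K * (cmod (f t y) * (D * l t powr a' * (1 + norm y) ^ L))"
        unfolding norm_mult by (intro mult_left_mono D(2) t) auto
      also have "\<dots> = ((1 + norm y) ^ (K + L) * cmod (f t y)) * (D * l t powr a')"
        by (simp add: power_add mult_ac)
      also have "\<dots> \<le> (C * l t powr a) * (D * l t powr a')"
        using D(1) by (intro mult_right_mono C(2) t) auto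
      finally show ?thesis by (simp add: powr_add mult_ac)
    qed
    then show ?thesis by blast
  qed
  then show ?thesis using assms unfolding rapid_def symb_def by (auto intro!: continuous_intros)
qed

lemma along_symb_add:
  "along (symb a) n b \<Longrightarrow> along (symb a) n c \<Longrightarrow> along (symb a) n (\<lambda>t y. b t y + c t y)"
  by (rule along_add) (rule symb_add)

lemma along_rapid_add:
  "along (rapid a) n b \<Longrightarrow> along (rapid a) n c \<Longrightarrow> along (rapid a) n (\<lambda>t y. b t y + c t y)"
  by (rule along_add) (rule rapid_add)

lemma along_symb_mult:
  "along (symb a) n b \<Longrightarrow> along (symb a') n c \<Longrightarrow> along (symb (a + a')) n (\<lambda>t y. b t y * c t y)"
  by (rule along_mult[where P = "symb a" and Q = "symb a'"]) (rule symb_mult symb_add; assumption)+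

lemma along_rapid_mult_symb:
  "along (rapid a) n f \<Longrightarrow> along (symb a') n b \<Longrightarrow> along (rapid (a + a')) n (\<lambda>t y. f t y * b t y)"
  by (rule along_mult[where P = "rapid a" and Q = "symb a'"]) (rule rapid_mult_symb rapid_add; assumption)+

lemma along_symb_const: "along (symb 0) n (\<lambda>t y. c)"
proof (induction n arbitrary: c)
  case 0
  have "\<forall>t\<in>T. \<forall>y::real ^ 'n. cmod c \<le> cmod c * l t powr 0 * (1 + norm y) ^ 0"
    using l_ge_1 by force
  then show ?case unfolding along.simps symb_def by (blast intro: continuous_intros)
next
  case (Suc n)
  have "directional_derivative (\<lambda>t y. c) (\<lambda>t y. 0)"
    by (auto simp: directional_derivative_def)
  then show ?case using Suc[of 0] Suc[of c] along_base by auto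
qed

lemma along_symb_cmult:
  assumes "along (symb a) n b"
  shows "along (symb a) n (\<lambda>t y. c * b t y)"
  using along_symb_mult[OF along_symb_const assms, of c] by simp

lemma along_rapid_cmult:
  assumes "along (rapid a) n b"
  shows "along (rapid a) n (\<lambda>t y. b t y * c)"
  using along_rapid_mult_symb[OF assms along_symb_const, of c] by simp

lemma along_symb_sum:
  assumes "\<And>i. i \<in> I \<Longrightarrow> along (symb a) n (b i)" "finite I" "0 \<le> a"
  shows "along (symb a) n (\<lambda>t y. \<Sum>i\<in>I. b i t y)"
  using assms(2,1)
proof (induction I)
  case empty
  have "along (symb a) n (\<lambda>t y. 0)"
    by (rule along_mono[OF _ along_symb_const]) (rule symb_mono[OF _ assms(3)])
  then show ?case by simp
next
  case (insert i I)
  then show ?case using along_symb_add[of a n "b i"] by simp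
qed

end

text \<open>The phase \<open>\<Phi>\<close> has derivative \<open>g\<close> along \<open>e\<close>, of size at least \<open>l^p\<close> up to an error that is smaller by a
  factor \<open>l\<close> but may grow polynomially in \<open>y\<close>. In particular \<open>g\<close> may vanish for large \<open>y\<close>.\<close>

locale nonstationary_phase = phase_family T l e
  for T :: "'t set" and l :: "'t \<Rightarrow> real" and e :: "real ^ 'n::finite" +
  fixes \<Phi> g g' :: "'t \<Rightarrow> real ^ 'n \<Rightarrow> real" and p :: nat and d C :: real and M :: nat
  assumes cont: "t \<in> T \<Longrightarrow> continuous_on UNIV (\<Phi> t)" "t \<in> T \<Longrightarrow> continuous_on UNIV (g t)"
    and deriv_phase: "t \<in> T \<Longrightarrow> ((\<lambda>s. \<Phi> t (y + s *\<^sub>R e)) has_real_derivative g t y) (at 0)"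
    and deriv_g: "t \<in> T \<Longrightarrow> ((\<lambda>s. g t (y + s *\<^sub>R e)) has_real_derivative g' t y) (at 0)"
    and g'_symb: "along (symb (real p - 1)) n (\<lambda>t y. complex_of_real (g' t y))"
    and p_pos: "1 \<le> p" and d_pos: "0 < d"
    and g_lower: "t \<in> T \<Longrightarrow> d * l t ^ p \<le> \<bar>g t y\<bar> + C * l t ^ (p - 1) * (1 + norm y) ^ M"
begin

text \<open>The multiplier of the integration by parts: \<open>(1 + \<partial>\<^sub>e) exp (i \<Phi>) = (1 + i g) exp (i \<Phi>)\<close>. The summand
  \<open>1\<close> keeps the denominator away from zero where \<open>g\<close> vanishes, so that no cutoff function is needed.\<close>

definition h :: "'t \<Rightarrow> real ^ 'n \<Rightarrow> complex" where
  "h t y = inverse (1 + \<i> * complex_of_real (g t y))"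

lemma one_plus_i_nz: "1 + \<i> * complex_of_real r \<noteq> 0"
  by (simp add: complex_eq_iff)

lemma h_le: "cmod (h t y) \<le> 1" "cmod (h t y) * \<bar>g t y\<bar> \<le> 1"
proof -
  have eq: "cmod (1 + \<i> * complex_of_real (g t y)) = sqrt (1 + (g t y)\<^sup>2)"
    by (simp add: cmod_def)
  have "\<bar>g t y\<bar> \<le> sqrt (1 + (g t y)\<^sup>2)" by (rule real_le_rsqrt) simp
  moreover have q: "1 \<le> sqrt (1 + (g t y)\<^sup>2)" by (rule real_le_rsqrt) simp
  moreover have "0 < sqrt (1 + (g t y)\<^sup>2)" using q by (rule less_le_trans[OF zero_less_one])
  ultimately show "cmod (h t y) \<le> 1" "cmod (h t y) * \<bar>g t y\<bar> \<le> 1"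
    unfolding h_def norm_inverse eq
    by (simp_all only: inverse_eq_divide times_divide_eq_left pos_divide_le_eq mult_1)
qed

lemma continuous_h: "t \<in> T \<Longrightarrow> continuous_on UNIV (h t)"
  unfolding h_def by (intro continuous_intros cont ballI one_plus_i_nz)

text \<open>Multiplying the lower bound for \<open>g\<close> by \<open>|h|\<close> and using \<open>|g h| \<le> 1\<close> turns the decay \<open>l^(- k)\<close> of \<open>h\<close>
  into the decay \<open>l^(- k - 1)\<close>, at the price of another power of \<open>1 + |y|\<close>.
  Starting from \<open>|h| \<le> 1\<close> this reaches \<open>l^(- p)\<close>.\<close>

lemma h_decay: "k \<le> p \<Longrightarrow> \<exists>D\<ge>0. \<forall>t\<in>T. \<forall>y. l t ^ k * cmod (h t y) \<le> D * (1 + norm y) ^ (k * M)"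
proof (induction k)
  case 0
  then show ?case using h_le(1) by (intro exI[of _ 1]) auto
next
  case (Suc k)
  then obtain D where D: "0 \<le> D" "\<And>t y. t \<in> T \<Longrightarrow> l t ^ k * cmod (h t y) \<le> D * (1 + norm y) ^ (k * M)"
    by auto
  have "l t ^ Suc k * cmod (h t y) \<le> ((1 + \<bar>C\<bar> * D) / d) * (1 + norm y) ^ (Suc k * M)" if t: "t \<in> T" for t y
  proof -
    note l1 = l_ge_1[OF t]
    have "p = (p - Suc k) + Suc k" "p - 1 = (p - Suc k) + k" using Suc.prems by auto
    then have pw: "l t ^ p = l t ^ (p - Suc k) * l t ^ Suc k" "l t ^ (p - 1) = l t ^ (p - Suc k) * l t ^ k"
      by (metis power_add)+
    have pos: "0 < l t ^ (p - Suc k)" "1 \<le> l t ^ (p - Suc k)" using l1 by auto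
    have W: "1 \<le> (1 + norm y) ^ (Suc k * M)" by (rule one_le_power) simp
    have "d * l t ^ p * cmod (h t y) \<le> (\<bar>g t y\<bar> + C * l t ^ (p - 1) * (1 + norm y) ^ M) * cmod (h t y)"
      by (intro mult_right_mono g_lower t) auto
    also have "\<dots> \<le> (\<bar>g t y\<bar> + \<bar>C\<bar> * l t ^ (p - 1) * (1 + norm y) ^ M) * cmod (h t y)"
      using l1 by (intro mult_right_mono add_left_mono) auto
    also have "\<dots> = cmod (h t y) * \<bar>g t y\<bar> + l t ^ (p - Suc k) * (\<bar>C\<bar> * (1 + norm y) ^ M * (l t ^ k * cmod (h t y)))"
      unfolding pw by (simp add: algebra_simps)
    also have "\<dots> \<le> l t ^ (p - Suc k) * 1 + l t ^ (p - Suc k) * (\<bar>C\<bar> * (1 + norm y) ^ M * (D * (1 + norm y) ^ (k * M)))"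
      using h_le(2)[of t y] pos D(2)[OF t, of y] by (intro add_mono mult_left_mono) auto
    also have "\<dots> = l t ^ (p - Suc k) * (1 + \<bar>C\<bar> * D * (1 + norm y) ^ (Suc k * M))"
      by (simp add: power_add algebra_simps)
    also have "\<dots> \<le> l t ^ (p - Suc k) * ((1 + \<bar>C\<bar> * D) * (1 + norm y) ^ (Suc k * M))"
      using pos W by (intro mult_left_mono) (auto simp: algebra_simps)
    finally have "l t ^ (p - Suc k) * (d * (l t ^ Suc k * cmod (h t y)))
       \<le> l t ^ (p - Suc k) * ((1 + \<bar>C\<bar> * D) * (1 + norm y) ^ (Suc k * M))"
      unfolding pw by (simp only: mult_ac)
    then have "d * (l t ^ Suc k * cmod (h t y)) \<le> (1 + \<bar>C\<bar> * D) * (1 + norm y) ^ (Suc k * M)"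
      using pos(1) by (simp only: mult_le_cancel_left_pos)
    then show ?thesis using d_pos by (simp only: pos_le_divide_eq times_divide_eq_left mult.commute[of d])
  qed
  then show ?case using D(1) d_pos by (intro exI[of _ "(1 + \<bar>C\<bar> * D) / d"]) auto
qed

lemma symb_h: "symb (- real p) h"
proof -
  obtain D where D: "\<And>t y. t \<in> T \<Longrightarrow> l t ^ p * cmod (h t y) \<le> D * (1 + norm y) ^ (p * M)"
    using h_decay[of p] by auto
  have "cmod (h t y) \<le> D * l t powr (- real p) * (1 + norm y) ^ (p * M)" if "t \<in> T" for t y
    using D[OF that, of y] l_ge_1[OF that]
    by (simp add: powr_minus powr_realpow field_simps)
  then show ?thesis unfolding symb_def using continuous_h by blast
qed

lemma deriv_h:
  assumes "t \<in> T"
  shows "((\<lambda>s. h t (y + s *\<^sub>R e)) has_vector_derivative - \<i> * (complex_of_real (g' t y) * (h t y * h t y))) (at 0)"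
proof -
  have "((\<lambda>s. 1 + \<i> * complex_of_real (g t (y + s *\<^sub>R e))) has_vector_derivative \<i> * complex_of_real (g' t y)) (at 0)"
    by (rule derivative_eq_intros deriv_g[OF assms] refl)+ simp
  moreover have "(inverse has_field_derivative - (inverse z * 1 * inverse z)) (at z)" if "z \<noteq> 0" for z :: complex
    using that by (auto intro!: derivative_eq_intros)
  ultimately show ?thesis
    using field_vector_diff_chain_at[of "\<lambda>s. 1 + \<i> * complex_of_real (g t (y + s *\<^sub>R e))" "\<i> * complex_of_real (g' t y)" 0
        inverse "- (h t y * 1 * h t y)"] one_plus_i_nz
    by (simp add: h_def o_def mult_ac)
qed

text \<open>By \<open>h' = - i g' h h\<close>, where \<open>g'\<close> has order \<open>p - 1\<close>, every derivative of \<open>h\<close> inherits the order of \<open>h\<close>.\<close>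

lemma along_h: "along (symb (- real p)) n h"
proof (induction n)
  case 0
  then show ?case using symb_h by simp
next
  case (Suc n)
  have "directional_derivative h (\<lambda>t y. - \<i> * (complex_of_real (g' t y) * (h t y * h t y)))"
    unfolding directional_derivative_def using deriv_h by blast
  moreover have "along (symb (real p - 1 + (- real p + - real p))) n (\<lambda>t y. - \<i> * (complex_of_real (g' t y) * (h t y * h t y)))"
    by (intro along_symb_cmult along_symb_mult g'_symb Suc)
  then have "along (symb (- real p)) n (\<lambda>t y. - \<i> * (complex_of_real (g' t y) * (h t y * h t y)))"
    by (rule along_mono[rotated]) (erule symb_mono, simp)
  ultimately show ?case using symb_h by auto
qed

lemma rapid_integrable:
  assumes "rapid a f" "t \<in> T"
  shows "integrable lborel (\<lambda>y. exp (\<i> * complex_of_real (\<Phi> t y)) * f t y)"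
    and "continuous_on UNIV (\<lambda>y. exp (\<i> * complex_of_real (\<Phi> t y)) * f t y)"
    and "\<exists>C. \<forall>y. (1 + norm y) ^ (2 * CARD('n)) * cmod (exp (\<i> * complex_of_real (\<Phi> t y)) * f t y) \<le> C"
proof -
  obtain C where C: "\<And>t y. t \<in> T \<Longrightarrow> (1 + norm y) ^ (2 * CARD('n)) * cmod (f t y) \<le> C * l t powr a"
    using rapidE[OF assms(1)] by blast
  show c: "continuous_on UNIV (\<lambda>y. exp (\<i> * complex_of_real (\<Phi> t y)) * f t y)"
    using assms unfolding rapid_def by (intro continuous_intros cont) auto
  have b: "(1 + norm y) ^ (2 * CARD('n)) * cmod (exp (\<i> * complex_of_real (\<Phi> t y)) * f t y) \<le> C * l t powr a" for y
    using C[OF assms(2)] by (simp add: norm_mult)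
  then show "\<exists>C. \<forall>y. (1 + norm y) ^ (2 * CARD('n)) * cmod (exp (\<i> * complex_of_real (\<Phi> t y)) * f t y) \<le> C" by blast
  show "integrable lborel (\<lambda>y. exp (\<i> * complex_of_real (\<Phi> t y)) * f t y)"
    by (rule integrable_rapid(1)[OF c b])
qed

text \<open>With \<open>E = exp (i \<Phi>)\<close> and \<open>k = (f h)'\<close> one has \<open>(E f h)' = E f - E (f h - k)\<close>, and the left side integrates to zero.\<close>

lemma integration_by_parts:
  assumes "directional_derivative (\<lambda>t y. f t y * h t y) k" "t \<in> T"
    and f: "rapid a f" and k: "rapid b k" and fh: "rapid b (\<lambda>t y. f t y * h t y)"
  shows "(LINT y|lborel. exp (\<i> * complex_of_real (\<Phi> t y)) * f t y)
       = (LINT y|lborel. exp (\<i> * complex_of_real (\<Phi> t y)) * (f t y * h t y + k t y * - 1))"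
proof -
  let ?E = "\<lambda>y. exp (\<i> * complex_of_real (\<Phi> t y))"
  let ?r = "\<lambda>y. f t y * h t y + k t y * - 1"
  have "rapid b (\<lambda>t y. k t y * - 1)"
    using along_rapid_cmult[of b 0 k "- 1"] k by simp
  then have r: "rapid b (\<lambda>t y. f t y * h t y + k t y * - 1)"
    by (intro rapid_add fh)
  note F = rapid_integrable[OF f assms(2)] rapid_integrable[OF r assms(2)] rapid_integrable[OF fh assms(2)]
  obtain C1 where C1: "\<And>y. (1 + norm y) ^ (2 * CARD('n)) * cmod (?E y * f t y) \<le> C1" using F(3) by blast
  obtain C2 where C2: "\<And>y. (1 + norm y) ^ (2 * CARD('n)) * cmod (?E y * ?r y) \<le> C2" using F(6) by blast
  obtain C3 where C3: "\<And>y. (1 + norm y) ^ (2 * CARD('n)) * cmod (?E y * (f t y * h t y)) \<le> C3" using F(9) by blast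
  have "(LINT y|lborel. ?E y * f t y - ?E y * ?r y) = 0"
  proof (rule integral_directional_derivative_eq_0[OF F(8) C3])
    show "continuous_on UNIV (\<lambda>y. ?E y * f t y - ?E y * ?r y)"
      by (rule continuous_on_diff[OF F(2) F(5)])
    show "(1 + norm y) ^ (2 * CARD('n)) * cmod (?E y * f t y - ?E y * ?r y) \<le> C1 + C2" for y
    proof -
      have "(1 + norm y) ^ (2 * CARD('n)) * cmod (?E y * f t y - ?E y * ?r y)
         \<le> (1 + norm y) ^ (2 * CARD('n)) * (cmod (?E y * f t y) + cmod (?E y * ?r y))"
        by (intro mult_left_mono norm_triangle_ineq4) auto
      then show ?thesis using C1[of y] C2[of y] by (simp only: distrib_left)
    qed
    show "((\<lambda>s. ?E (y + s *\<^sub>R e) * (f t (y + s *\<^sub>R e) * h t (y + s *\<^sub>R e)))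
        has_vector_derivative ?E y * f t y - ?E y * ?r y) (at 0)" for y
    proof -
      have "((\<lambda>s. \<i> * complex_of_real (\<Phi> t (y + s *\<^sub>R e))) has_vector_derivative \<i> * complex_of_real (g t y)) (at 0)"
        by (rule derivative_eq_intros deriv_phase[OF assms(2)] refl)+
      then have E: "((\<lambda>s. ?E (y + s *\<^sub>R e)) has_vector_derivative \<i> * complex_of_real (g t y) * ?E y) (at 0)"
        using field_vector_diff_chain_at[of "\<lambda>s. \<i> * complex_of_real (\<Phi> t (y + s *\<^sub>R e))" _ 0 exp "?E y"]
        by (simp add: o_def DERIV_exp)
      have K: "((\<lambda>s. f t (y + s *\<^sub>R e) * h t (y + s *\<^sub>R e)) has_vector_derivative k t y) (at 0)"
        using assms(1,2) by (auto simp: directional_derivative_def)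
      have one: "\<i> * complex_of_real (g t y) * h t y = 1 - h t y"
        using one_plus_i_nz[of "g t y"] unfolding h_def by (simp add: field_simps)
      have "?E y * k t y + \<i> * complex_of_real (g t y) * ?E y * (f t y * h t y)
         = ?E y * (k t y + f t y * (\<i> * complex_of_real (g t y) * h t y))"
        by (simp add: algebra_simps)
      also have "\<dots> = ?E y * f t y - ?E y * ?r y"
        unfolding one by (simp add: algebra_simps)
      finally show ?thesis using has_vector_derivative_mult[OF E K] by simp
    qed
  qed
  then show ?thesis
    by (subst (asm) Bochner_Integration.integral_diff[OF F(1) F(4)]) simp
qed

text \<open>Each integration by parts replaces \<open>f\<close> by \<open>f h - (f h)'\<close>, which gains the order \<open>- p\<close> of \<open>h\<close> and costs
  one derivative.\<close>

theorem oscillatory_integral_decay: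
  assumes "along (rapid a) n f"
  shows "\<exists>D. \<forall>t\<in>T. cmod (LINT y|lborel. exp (\<i> * complex_of_real (\<Phi> t y)) * f t y) \<le> D * l t powr (a - real n * real p)"
  using assms
proof (induction n arbitrary: a f)
  case 0
  then have f: "rapid a f" by simp
  obtain D where D: "\<And>t y. t \<in> T \<Longrightarrow> (1 + norm y) ^ (2 * CARD('n)) * cmod (f t y) \<le> D * l t powr a"
    using rapidE[OF f] by blast
  let ?I = "LINT y|lborel. inverse ((1 + norm (y::real ^ 'n)) ^ (2 * CARD('n)))"
  have "cmod (LINT y|lborel. exp (\<i> * complex_of_real (\<Phi> t y)) * f t y) \<le> (D * l t powr a) * ?I" if t: "t \<in> T" for t
    using D[OF t] by (intro integrable_rapid(2) rapid_integrable(2)[OF f t]) (simp add: norm_mult)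
  then show ?case by (intro exI[of _ "D * ?I"]) (simp add: mult_ac)
next
  case (Suc n)
  have fh: "along (rapid (a - real p)) (Suc n) (\<lambda>t y. f t y * h t y)"
    using along_rapid_mult_symb[OF Suc.prems along_h] by simp
  then obtain k where k: "directional_derivative (\<lambda>t y. f t y * h t y) k" "along (rapid (a - real p)) n k" by auto
  have "along (rapid (a - real p)) n (\<lambda>t y. f t y * h t y + k t y * - 1)"
    by (intro along_rapid_add along_rapid_cmult k along_SucD[OF fh])
  from Suc.IH[OF this] obtain D where D: "\<And>t. t \<in> T \<Longrightarrow>
    cmod (LINT y|lborel. exp (\<i> * complex_of_real (\<Phi> t y)) * (f t y * h t y + k t y * - 1))
      \<le> D * l t powr (a - real p - real n * real p)" by blast
  have "cmod (LINT y|lborel. exp (\<i> * complex_of_real (\<Phi> t y)) * f t y) \<le> D * l t powr (a - real (Suc n) * real p)"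
    if t: "t \<in> T" for t
    using D[OF t] integration_by_parts[OF k(1) t along_base[OF Suc.prems] along_base[OF k(2)] along_base[OF fh]]
    by (simp add: algebra_simps)
  then show ?case by blast
qed

end

section \<open>Decay of the transform off the graph of the gradient\<close>

lemma schwartz_continuous: "f \<in> schwartz_space \<Longrightarrow> continuous_on UNIV f"
  using schwartz_differentiable[of f "[]"]
  by (intro differentiable_imp_continuous_on) (auto simp: differentiable_on_def)

lemma STFT_of_phase:
  fixes \<phi> :: "real ^ 'n::finite \<Rightarrow> real"
  assumes \<phi>: "continuous_on UNIV \<phi>" and \<psi>: "\<psi> \<in> schwartz_space"
  shows "STFT \<psi> (distribution_of (\<lambda>y. exp (\<i> * complex_of_real (\<phi> y)))) x \<xi>
    = complex_of_real ((2 * pi) powr (- real CARD('n) / 2)) * exp (- (\<i> * complex_of_real (x \<bullet> \<xi>)))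
      * (LINT v|lborel. exp (\<i> * complex_of_real (\<phi> (x + v) - v \<bullet> \<xi>)) * cnj (\<psi> v))"
proof -
  let ?f = "\<lambda>y. exp (\<i> * complex_of_real (\<phi> y)) * cnj (modulation \<xi> (translation x \<psi>) y)"
  have m: "?f \<in> borel_measurable borel"
    unfolding modulation_def translation_def
    by (intro borel_measurable_continuous_onI continuous_intros \<phi> continuous_on_compose2[OF schwartz_continuous[OF \<psi>]]) auto
  have "?f (x + v) = exp (- (\<i> * complex_of_real (x \<bullet> \<xi>)))
      * (exp (\<i> * complex_of_real (\<phi> (x + v) - v \<bullet> \<xi>)) * cnj (\<psi> v))" for v
  proof -
    have "exp (\<i> * complex_of_real (\<phi> (x + v))) * exp (- (\<i> * complex_of_real ((x + v) \<bullet> \<xi>)))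
        = exp (- (\<i> * complex_of_real (x \<bullet> \<xi>))) * exp (\<i> * complex_of_real (\<phi> (x + v) - v \<bullet> \<xi>))"
      unfolding exp_add[symmetric] by (rule arg_cong[of _ _ exp]) (simp add: inner_add_left algebra_simps)
    then show ?thesis
      by (simp add: modulation_def translation_def exp_cnj)
  qed
  then have "(LINT y|lborel. ?f y) = exp (- (\<i> * complex_of_real (x \<bullet> \<xi>)))
      * (LINT v|lborel. exp (\<i> * complex_of_real (\<phi> (x + v) - v \<bullet> \<xi>)) * cnj (\<psi> v))"
    using lborel_integral_affine[OF m, of 1 x] by simp
  then show ?thesis unfolding STFT_def distribution_of_def by simp
qed

lemma norm_STFT_of_phase:
  fixes \<phi> :: "real ^ 'n::finite \<Rightarrow> real"
  assumes \<phi>: "continuous_on UNIV \<phi>" and \<psi>: "\<psi> \<in> schwartz_space"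
  shows "cmod (STFT \<psi> (distribution_of (\<lambda>y. exp (\<i> * complex_of_real (\<phi> y)))) x \<xi>)
    = (2 * pi) powr (- real CARD('n) / 2)
      * cmod (LINT v|lborel. exp (\<i> * complex_of_real (\<phi> (x + v) - v \<bullet> \<xi>)) * cnj (\<psi> v))"
  unfolding STFT_of_phase[OF assms] norm_mult by simp

lemma STFT_of_phase_bounded:
  fixes \<phi> :: "real ^ 'n::finite \<Rightarrow> real"
  assumes \<phi>: "continuous_on UNIV \<phi>" and \<psi>: "\<psi> \<in> schwartz_space"
  obtains B where "0 \<le> B" "\<And>x \<xi>. cmod (STFT \<psi> (distribution_of (\<lambda>y. exp (\<i> * complex_of_real (\<phi> y)))) x \<xi>) \<le> B"
proof -
  obtain C where C: "\<And>v. (1 + norm v) ^ (2 * CARD('n)) * cmod (\<psi> v) \<le> C"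
    using schwartz_bound[OF \<psi>, of "2 * CARD('n)" "[]"] by auto
  let ?B = "(2 * pi) powr (- real CARD('n) / 2) * (C * (LINT y|lborel. inverse ((1 + norm (y::real ^ 'n)) ^ (2 * CARD('n)))))"
  have B: "cmod (STFT \<psi> (distribution_of (\<lambda>y. exp (\<i> * complex_of_real (\<phi> y)))) x \<xi>) \<le> ?B" for x \<xi>
    unfolding norm_STFT_of_phase[OF assms]
  proof (intro mult_left_mono integrable_rapid(2))
    show "continuous_on UNIV (\<lambda>v. exp (\<i> * complex_of_real (\<phi> (x + v) - v \<bullet> \<xi>)) * cnj (\<psi> v))"
      by (intro continuous_intros continuous_on_compose2[OF \<phi>] schwartz_continuous \<psi>) auto
  qed (use C in \<open>auto simp: norm_mult\<close>)
  from that[OF order_trans[OF norm_ge_zero B] B] show ?thesis .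
qed

context phase_family
begin

lemma along_rapid_cnj_schwartz:
  assumes "e = axis i 1"
  shows "\<psi> \<in> schwartz_space \<Longrightarrow> along (rapid 0) n (\<lambda>t y. cnj (\<psi> y))"
proof (induction n arbitrary: \<psi>)
  case base: 0
  have "\<exists>C. \<forall>t\<in>T. \<forall>y. (1 + norm y) ^ K * cmod (cnj (\<psi> y)) \<le> C * l t powr 0" for K
  proof -
    obtain C where C: "\<And>v. (1 + norm v) ^ K * cmod (\<psi> v) \<le> C"
      using schwartz_bound[OF base, of K "[]"] by auto
    then show ?thesis using l_ge_1 by (intro exI[of _ C]) force
  qed
  then show ?case
    unfolding along.simps rapid_def using schwartz_continuous[OF base] by (auto intro!: continuous_intros)
next
  case (Suc n)
  have "((\<lambda>s. cnj (\<psi> (y + s *\<^sub>R e))) has_vector_derivative cnj (partial i \<psi> y)) (at 0)" for y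
    unfolding assms
    by (intro bounded_linear.has_vector_derivative[OF bounded_linear_cnj] has_partial)
       (use schwartz_differentiable[OF Suc.prems, of "[]"] in simp)
  then have "directional_derivative (\<lambda>t y. cnj (\<psi> y)) (\<lambda>t y. cnj (partial i \<psi> y))"
    by (simp add: directional_derivative_def)
  moreover have "along (rapid 0) n (\<lambda>t y. cnj (partial i \<psi> y))"
    by (intro Suc.IH schwartz_partial Suc.prems)
  moreover have "rapid 0 (\<lambda>t y. cnj (\<psi> y))"
    by (rule along_base[OF Suc.IH[OF Suc.prems]])
  ultimately show ?case unfolding along.simps by blast
qed

lemma along_symb_mi_power:
  assumes e: "e = axis i 1" and X: "\<And>t. t \<in> T \<Longrightarrow> norm (X t) \<le> R"
  shows "mi_order \<beta> \<le> k \<Longrightarrow>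
    along (symb (real k)) n (\<lambda>t y. complex_of_real (mi_power (l t *\<^sub>R X t + y) \<beta>))"
proof (induction n arbitrary: \<beta>)
  case base: 0
  have "cmod (complex_of_real (mi_power (l t *\<^sub>R X t + y) \<beta>))
     \<le> (1 + \<bar>R\<bar>) ^ k * l t powr (real k) * (1 + norm y) ^ k" if t: "t \<in> T" for t y
  proof -
    note l1 = l_ge_1[OF t]
    have R: "norm (X t) \<le> \<bar>R\<bar>" using X[OF t] by simp
    have "1 * (1 * 1) \<le> l t * ((1 + \<bar>R\<bar>) * (1 + norm y))"
      using l1 by (intro mult_mono) auto
    then have "(l t * ((1 + \<bar>R\<bar>) * (1 + norm y))) ^ mi_order \<beta> \<le> (l t * ((1 + \<bar>R\<bar>) * (1 + norm y))) ^ k"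
      using base by (intro power_increasing) auto
    with mi_power_dilate_bound[OF R l1, of y \<beta>]
    have "\<bar>mi_power (l t *\<^sub>R X t + y) \<beta>\<bar> \<le> (l t * ((1 + \<bar>R\<bar>) * (1 + norm y))) ^ k" by linarith
    then show ?thesis using l1 by (simp add: power_mult_distrib powr_realpow mult_ac)
  qed
  moreover have "continuous_on UNIV (\<lambda>y. complex_of_real (mi_power (l t *\<^sub>R X t + y) \<beta>))" for t
    by (intro continuous_intros continuous_on_compose2[OF continuous_mi_power]) auto
  ultimately show ?case unfolding along.simps symb_def by blast
next
  case (Suc n)
  have "((\<lambda>s. complex_of_real (mi_power (l t *\<^sub>R X t + (y + s *\<^sub>R e)) \<beta>)) has_vector_derivative
      complex_of_real (real (\<beta> i)) * complex_of_real (mi_power (l t *\<^sub>R X t + y) (mi_dec i \<beta>))) (at 0)" for t y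
    using has_vector_derivative_of_real[OF
        GDERIV_along[OF GDERIV_mi_power[of \<beta> "l t *\<^sub>R X t + y"], of e]]
    by (simp add: e inner_axis' add.assoc)
  then have "directional_derivative (\<lambda>t y. complex_of_real (mi_power (l t *\<^sub>R X t + y) \<beta>))
     (\<lambda>t y. complex_of_real (real (\<beta> i)) * complex_of_real (mi_power (l t *\<^sub>R X t + y) (mi_dec i \<beta>)))"
    by (simp add: directional_derivative_def)
  moreover have "mi_order (mi_dec i \<beta>) \<le> k"
    using Suc.prems unfolding mi_order_def mi_dec_def by (rule order_trans[rotated]) (auto intro!: sum_mono)
  then have "along (symb (real k)) n (\<lambda>t y. complex_of_real (real (\<beta> i)) * complex_of_real (mi_power (l t *\<^sub>R X t + y) (mi_dec i \<beta>)))"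
    by (intro along_symb_cmult Suc.IH)
  moreover have "symb (real k) (\<lambda>t y. complex_of_real (mi_power (l t *\<^sub>R X t + y) \<beta>))"
    by (rule along_base[OF Suc.IH[OF Suc.prems]])
  ultimately show ?case unfolding along.simps by blast
qed

end

text \<open>Some component \<open>i\<close> of \<open>\<nabla>\<phi>\<^sub>m(x) - \<xi>\<close> stays away from zero near \<open>(x\<^sub>0, \<xi>\<^sub>0)\<close>. The derivative in the
  \<open>i\<close>-th direction of the phase \<open>\<phi>(l x + y) - l^(m - 1) y \<xi>\<close> is then at least of size \<open>l^(m - 1)\<close> up to an admissible
  error, and non-stationary phase applies with \<open>p = m - 1\<close>.\<close>

theorem not_in_WFg_off_gradient:
  fixes c :: "('n::finite \<Rightarrow> nat) \<Rightarrow> real" and \<psi> :: "real ^ 'n \<Rightarrow> complex"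
  assumes m: "m \<ge> 2" and \<psi>: "\<psi> \<in> schwartz_space"
    and off: "\<xi>\<^sub>0 \<noteq> mi_poly_grad {\<alpha>. mi_order \<alpha> = m} c x\<^sub>0"
  shows "(x\<^sub>0, \<xi>\<^sub>0) \<notin> WFg (real m - 1) \<psi>
    (distribution_of (\<lambda>y. exp (\<i> * complex_of_real (mi_poly {\<alpha>. mi_order \<alpha> \<le> m} c y))))"
proof -
  let ?A = "{\<alpha> :: 'n \<Rightarrow> nat. mi_order \<alpha> \<le> m}" and ?E = "{\<alpha> :: 'n \<Rightarrow> nat. mi_order \<alpha> = m}"
  let ?V = "STFT \<psi> (distribution_of (\<lambda>y. exp (\<i> * complex_of_real (mi_poly ?A c y))))"
  from off obtain i where i: "\<xi>\<^sub>0 $ i \<noteq> mi_poly_grad ?E c x\<^sub>0 $ i" by (auto simp: vec_eq_iff)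
  define d where "d = \<bar>mi_poly_grad ?E c x\<^sub>0 $ i - \<xi>\<^sub>0 $ i\<bar> / 2"
  define R where "R = norm x\<^sub>0 + 1"
  \<comment> \<open>Bounding the position keeps the error estimates uniform.\<close>
  define U where "U = {z. d < \<bar>mi_poly_grad ?E c (fst z) $ i - snd z $ i\<bar>} \<inter> {z. norm (fst z) < R}"
  have "open U"
    unfolding U_def
    by (intro open_Int open_Collect_less continuous_intros continuous_on_compose2[OF continuous_mi_poly_grad]) auto
  have "(x\<^sub>0, \<xi>\<^sub>0) \<in> U" and d: "0 < d"
    using i by (auto simp: U_def d_def R_def)
  have "bdd_above {l ^ N * cmod (?V (l *\<^sub>R x) ((l powr (real m - 1)) *\<^sub>R \<xi>)) | x \<xi> l. (x, \<xi>) \<in> U \<and> 0 < l}" for N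
  proof -
    obtain C where C: "0 \<le> C" "\<And>l x y. norm x \<le> R \<Longrightarrow> 1 \<le> l \<Longrightarrow>
      norm (mi_poly_grad ?A c (l *\<^sub>R x + y) - l ^ (m - 1) *\<^sub>R mi_poly_grad ?E c x)
        \<le> C * l ^ (m - 2) * (1 + norm y) ^ (m - 1)"
      using mi_poly_grad_asymptotics[OF m, of R c] by blast
    define T :: "(real \<times> (real ^ 'n) \<times> (real ^ 'n)) set" where "T = {1..} \<times> U"
    define \<Phi> where "\<Phi> t y = mi_poly ?A c (fst t *\<^sub>R fst (snd t) + y) - fst t ^ (m - 1) * (y \<bullet> snd (snd t))"
      for t :: "real \<times> (real ^ 'n) \<times> (real ^ 'n)" and y
    define g where "g t y = mi_poly_grad ?A c (fst t *\<^sub>R fst (snd t) + y) $ i - fst t ^ (m - 1) * (snd (snd t) $ i)"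
      for t :: "real \<times> (real ^ 'n) \<times> (real ^ 'n)" and y
    define g' where "g' t y = (\<Sum>\<alpha>\<in>?A. c \<alpha> * (real (\<alpha> i) * (real (\<alpha> i - 1) *
        mi_power (fst t *\<^sub>R fst (snd t) + y) (mi_dec i (mi_dec i \<alpha>)))))"
      for t :: "real \<times> (real ^ 'n) \<times> (real ^ 'n)" and y
    interpret phase_family T fst "axis i 1 :: real ^ 'n"
      by unfold_locales (auto simp: T_def)
    have T: "norm (fst (snd t)) \<le> R" "1 \<le> fst t"
      "d \<le> \<bar>mi_poly_grad ?E c (fst (snd t)) $ i - snd (snd t) $ i\<bar>" if "t \<in> T" for t
      using that by (auto simp: T_def U_def)
    interpret nonstationary_phase T fst "axis i 1 :: real ^ 'n" \<Phi> g g' "m - 1" d C "m - 1"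
    proof unfold_locales
      fix t assume t: "t \<in> T"
      show "continuous_on UNIV (\<Phi> t)"
        unfolding \<Phi>_def by (intro continuous_intros continuous_on_compose2[OF continuous_mi_poly]) auto
      show "continuous_on UNIV (g t)"
        unfolding g_def by (intro continuous_intros continuous_on_compose2[OF continuous_mi_poly_grad]) auto
      fix y
      let ?z = "fst t *\<^sub>R fst (snd t) + y"
      have "((\<lambda>s. mi_poly ?A c (?z + s *\<^sub>R axis i 1)) has_real_derivative mi_poly_grad ?A c ?z $ i) (at 0)"
        using GDERIV_along[OF GDERIV_mi_poly[of ?A c ?z], of "axis i 1"] by (simp add: inner_axis')
      moreover have "((\<lambda>s. fst t ^ (m - 1) * (y \<bullet> snd (snd t) + s * (snd (snd t) $ i))) has_real_derivative
          fst t ^ (m - 1) * (snd (snd t) $ i)) (at 0)"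
        by (auto intro!: derivative_eq_intros)
      ultimately have "((\<lambda>s. mi_poly ?A c (?z + s *\<^sub>R axis i 1) - fst t ^ (m - 1) * (y \<bullet> snd (snd t) + s * (snd (snd t) $ i)))
          has_real_derivative g t y) (at 0)"
        unfolding g_def by (rule DERIV_diff)
      then show "((\<lambda>s. \<Phi> t (y + s *\<^sub>R axis i 1)) has_real_derivative g t y) (at 0)"
        unfolding \<Phi>_def by (simp add: add.assoc inner_add_left inner_axis')
      have "((\<lambda>s. mi_power (?z + s *\<^sub>R axis i 1) \<beta>) has_real_derivative real (\<beta> i) * mi_power ?z (mi_dec i \<beta>)) (at 0)" for \<beta>
        using GDERIV_along[OF GDERIV_mi_power[of \<beta> ?z], of "axis i 1"] by (simp add: inner_axis')
      then have "((\<lambda>s. (\<Sum>\<alpha>\<in>?A. c \<alpha> * (real (\<alpha> i) * mi_power (?z + s *\<^sub>R axis i 1) (mi_dec i \<alpha>))))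
          has_real_derivative (\<Sum>\<alpha>\<in>?A. c \<alpha> * (real (\<alpha> i) * (real (mi_dec i \<alpha> i) * mi_power ?z (mi_dec i (mi_dec i \<alpha>)))))) (at 0)"
        by (intro DERIV_sum DERIV_cmult)
      from DERIV_diff[OF this DERIV_const[of "fst t ^ (m - 1) * (snd (snd t) $ i)"]]
      show "((\<lambda>s. g t (y + s *\<^sub>R axis i 1)) has_real_derivative g' t y) (at 0)"
        by (simp add: g_def g'_def mi_poly_grad_def add.assoc)
      show "d * fst t ^ (m - 1) \<le> \<bar>g t y\<bar> + C * fst t ^ (m - 1 - 1) * (1 + norm y) ^ (m - 1)"
      proof -
        let ?a = "mi_poly_grad ?A c ?z $ i" and ?b = "mi_poly_grad ?E c (fst (snd t)) $ i"
        have "\<bar>?a - fst t ^ (m - 1) * ?b\<bar> \<le> norm (mi_poly_grad ?A c ?z - fst t ^ (m - 1) *\<^sub>R mi_poly_grad ?E c (fst (snd t)))"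
          using component_le_norm_cart[of "mi_poly_grad ?A c ?z - fst t ^ (m - 1) *\<^sub>R mi_poly_grad ?E c (fst (snd t))" i] by simp
        also have "\<dots> \<le> C * fst t ^ (m - 1 - 1) * (1 + norm y) ^ (m - 1)"
          using C(2)[OF T(1,2)[OF t], of y] by (simp add: numeral_2_eq_2)
        finally have 1: "\<bar>?a - fst t ^ (m - 1) * ?b\<bar> \<le> C * fst t ^ (m - 1 - 1) * (1 + norm y) ^ (m - 1)" .
        have "d * fst t ^ (m - 1) \<le> \<bar>?b - snd (snd t) $ i\<bar> * fst t ^ (m - 1)"
          using T[OF t] by (intro mult_right_mono) auto
        also have "\<dots> = \<bar>fst t ^ (m - 1) * (?b - snd (snd t) $ i)\<bar>"
          using T(2)[OF t] by (simp add: abs_mult mult.commute)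
        also have "fst t ^ (m - 1) * (?b - snd (snd t) $ i) = g t y - (?a - fst t ^ (m - 1) * ?b)"
          by (simp add: g_def algebra_simps)
        finally show ?thesis using 1 by linarith
      qed
    next
      fix n
      have "along (symb (real (m - 2))) n (\<lambda>t y. \<Sum>\<alpha>\<in>?A. complex_of_real (c \<alpha> * (real (\<alpha> i) * real (\<alpha> i - 1))) *
          complex_of_real (mi_power (fst t *\<^sub>R fst (snd t) + y) (mi_dec i (mi_dec i \<alpha>))))"
      proof (rule along_symb_sum)
        fix \<alpha> assume \<alpha>: "\<alpha> \<in> ?A"
        show "along (symb (real (m - 2))) n (\<lambda>t y. complex_of_real (c \<alpha> * (real (\<alpha> i) * real (\<alpha> i - 1))) *
          complex_of_real (mi_power (fst t *\<^sub>R fst (snd t) + y) (mi_dec i (mi_dec i \<alpha>))))"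
        proof (cases "\<alpha> i \<ge> 2")
          case True
          then have "\<alpha> i \<noteq> 0" "mi_dec i \<alpha> i \<noteq> 0" by (auto simp: mi_dec_def)
          then have "Suc (mi_order (mi_dec i \<alpha>)) = mi_order \<alpha>"
            "Suc (mi_order (mi_dec i (mi_dec i \<alpha>))) = mi_order (mi_dec i \<alpha>)"
            by (simp_all only: mi_order_dec not_False_eq_True)
          with \<alpha> have "mi_order (mi_dec i (mi_dec i \<alpha>)) \<le> m - 2" by auto
          then show ?thesis
            by (intro along_symb_cmult along_symb_mi_power[OF refl T(1)])
        next
          case False
          then have "\<alpha> i = 0 \<or> \<alpha> i - 1 = 0" by auto
          moreover have "along (symb (real (m - 2))) n (\<lambda>t y. 0)"
            by (rule along_mono[OF _ along_symb_const]) (erule symb_mono, simp)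
          ultimately show ?thesis by auto
        qed
      qed (auto simp: finite_mi_order_le)
      moreover have "real (m - 2) = real (m - 1) - 1" using m by (simp add: of_nat_diff)
      ultimately show "along (symb (real (m - 1) - 1)) n (\<lambda>t y. complex_of_real (g' t y))"
        by (simp add: g'_def mult.assoc)
    qed (use m d in auto)
    obtain D where D: "\<And>t. t \<in> T \<Longrightarrow> cmod (LINT y|lborel. exp (\<i> * complex_of_real (\<Phi> t y)) * cnj (\<psi> y))
        \<le> D * fst t powr (0 - real N * real (m - 1))"
      using oscillatory_integral_decay[OF along_rapid_cnj_schwartz[OF refl \<psi>], of N] by blast
    obtain B where B: "0 \<le> B" "\<And>x \<xi>. cmod (?V x \<xi>) \<le> B"
      using STFT_of_phase_bounded[OF continuous_mi_poly \<psi>] by blast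
    let ?K = "(2 * pi) powr (- real CARD('n) / 2)"
    have "l ^ N * cmod (?V (l *\<^sub>R x) ((l powr (real m - 1)) *\<^sub>R \<xi>)) \<le> max B (?K * \<bar>D\<bar>)"
      if U: "(x, \<xi>) \<in> U" and l: "0 < l" for x \<xi> l
    proof (cases "1 \<le> l")
      case True
      then have t: "(l, x, \<xi>) \<in> T" using U by (simp add: T_def)
      have lp: "l powr (real m - 1) = l ^ (m - 1)"
        using l m by (simp add: powr_realpow[symmetric] of_nat_diff)
      have "cmod (?V (l *\<^sub>R x) ((l powr (real m - 1)) *\<^sub>R \<xi>))
         = ?K * cmod (LINT y|lborel. exp (\<i> * complex_of_real (\<Phi> (l, x, \<xi>) y)) * cnj (\<psi> y))"
        unfolding norm_STFT_of_phase[OF continuous_mi_poly \<psi>] lp by (simp add: \<Phi>_def)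
      also have "\<dots> \<le> ?K * (D * l powr (0 - real N * real (m - 1)))"
        using D[OF t] by (intro mult_left_mono) auto
      also have "\<dots> \<le> ?K * (\<bar>D\<bar> * l powr (- real N))"
      proof -
        have "real N * 1 \<le> real N * real (m - 1)" using m by (intro mult_left_mono) auto
        then have "l powr (0 - real N * real (m - 1)) \<le> l powr (- real N)"
          using True by (intro powr_mono) auto
        then show ?thesis by (intro mult_left_mono mult_mono) auto
      qed
      finally have "l ^ N * cmod (?V (l *\<^sub>R x) ((l powr (real m - 1)) *\<^sub>R \<xi>)) \<le> l ^ N * (?K * (\<bar>D\<bar> * l powr (- real N)))"
        using l by (intro mult_left_mono) auto
      also have "\<dots> = ?K * \<bar>D\<bar>"
        using l by (simp add: powr_minus powr_realpow)
      finally show ?thesis by simp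
    next
      case False
      then have "l ^ N \<le> 1" using l by (intro power_le_one) auto
      then have "l ^ N * cmod (?V (l *\<^sub>R x) ((l powr (real m - 1)) *\<^sub>R \<xi>)) \<le> 1 * B"
        using l by (intro mult_mono B) auto
      then show ?thesis by simp
    qed
    then show ?thesis by (intro bdd_aboveI[of _ "max B (?K * \<bar>D\<bar>)"]) (elim CollectE exE conjE, simp only:)
  qed
  from this \<open>open U\<close> \<open>(x\<^sub>0, \<xi>\<^sub>0) \<in> U\<close> have "\<exists>U. open U \<and> (x\<^sub>0, \<xi>\<^sub>0) \<in> U \<and>
    (\<forall>N. bdd_above {l ^ N * cmod (?V (l *\<^sub>R x) ((l powr (real m - 1)) *\<^sub>R \<xi>)) | x \<xi> l. (x, \<xi>) \<in> U \<and> 0 < l})"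
    by (intro exI[of _ U] conjI allI)
  then show ?thesis unfolding WFg_def mem_Collect_eq by (simp only: de_Morgan_conj not_not simp_thms)
qed

section \<open>Gaussian averages of the short-time Fourier transform\<close>

lemma lborel_integral_prod_Basis:
  fixes f :: "'a::euclidean_space \<Rightarrow> real \<Rightarrow> complex"
  assumes "\<And>b. b \<in> Basis \<Longrightarrow> integrable lborel (f b)"
  shows "(LINT x|lborel. (\<Prod>b\<in>Basis. f b (x \<bullet> b))) = (\<Prod>b\<in>(Basis :: 'a set). LINT t|lborel. f b t)"
proof -
  interpret product_sigma_finite "\<lambda>_::'a. lborel :: real measure" ..
  have [measurable]: "f b \<in> borel_measurable borel" if "b \<in> Basis" for b
    using borel_measurable_integrable[OF assms[OF that]] by simp
  have "(LINT x|lborel. (\<Prod>b\<in>Basis. f b (x \<bullet> b)))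
      = (LINT x|(\<Pi>\<^sub>M b\<in>(Basis :: 'a set). lborel). (\<Prod>b\<in>Basis. f b ((\<Sum>b\<in>Basis. x b *\<^sub>R b) \<bullet> b)))"
    by (subst lborel_eq[where 'a = 'a]) (rule integral_distr, measurable)
  also have "\<dots> = (LINT x|(\<Pi>\<^sub>M b\<in>(Basis :: 'a set). lborel). (\<Prod>b\<in>Basis. f b (x b)))"
    by simp
  also have "\<dots> = (\<Prod>b\<in>(Basis :: 'a set). LINT t|lborel. f b t)"
    by (rule product_integral_prod) (auto intro: assms)
  finally show ?thesis .
qed

lemma gaussian_fourier_transform_real:
  "integrable lborel (\<lambda>t. exp (\<i> * complex_of_real (t * v)) * complex_of_real (exp (- t\<^sup>2 / 2)))"
  "(LINT t|lborel. exp (\<i> * complex_of_real (t * v)) * complex_of_real (exp (- t\<^sup>2 / 2)))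
     = complex_of_real (sqrt (2 * pi) * exp (- v\<^sup>2 / 2))"
proof -
  have dens: "complex_of_real (exp (- t\<^sup>2 / 2)) = complex_of_real (sqrt (2 * pi)) * complex_of_real (std_normal_density t)" for t
    unfolding of_real_mult[symmetric] std_normal_density_def by simp
  have int: "integrable lborel (\<lambda>t. complex_of_real (std_normal_density t))"
    using integrable_std_normal_moment[of 0] by (simp add: complex_of_real_integrable_eq)
  show "integrable lborel (\<lambda>t. exp (\<i> * complex_of_real (t * v)) * complex_of_real (exp (- t\<^sup>2 / 2)))"
  proof (rule Bochner_Integration.integrable_bound)
    show "integrable lborel (\<lambda>t. complex_of_real (sqrt (2 * pi)) * complex_of_real (std_normal_density t))"
      by (intro integrable_mult_right int)
  qed (auto simp: dens[symmetric] norm_mult)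
  have "(LINT t|lborel. exp (\<i> * complex_of_real (t * v)) * complex_of_real (exp (- t\<^sup>2 / 2)))
     = (LINT t|lborel. complex_of_real (sqrt (2 * pi)) * (std_normal_density t *\<^sub>R iexp (v * t)))"
    unfolding dens by (intro Bochner_Integration.integral_cong) (auto simp: scaleR_conv_of_real mult_ac)
  also have "\<dots> = complex_of_real (sqrt (2 * pi)) * char std_normal_distribution v"
    unfolding char_def integral_mult_right_zero
    by (subst integral_density) (auto simp: normal_density_nonneg)
  also have "\<dots> = complex_of_real (sqrt (2 * pi) * exp (- v\<^sup>2 / 2))"
    unfolding char_std_normal_distribution by simp
  finally show "(LINT t|lborel. exp (\<i> * complex_of_real (t * v)) * complex_of_real (exp (- t\<^sup>2 / 2)))
     = complex_of_real (sqrt (2 * pi) * exp (- v\<^sup>2 / 2))" .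
qed

lemma gaussian_fourier_transform:
  fixes v :: "'a::euclidean_space"
  shows "(LINT w|lborel. exp (\<i> * complex_of_real (w \<bullet> v)) * complex_of_real (exp (- (norm w)\<^sup>2 / 2)))
     = complex_of_real ((2 * pi) powr (real DIM('a) / 2) * exp (- (norm v)\<^sup>2 / 2))"
proof -
  have nrm: "(norm x)\<^sup>2 = (\<Sum>b\<in>Basis. (x \<bullet> b)\<^sup>2)" for x :: 'a
    unfolding power2_norm_eq_inner by (subst euclidean_inner) (simp add: power2_eq_square)
  have "exp (\<i> * complex_of_real (w \<bullet> v)) * complex_of_real (exp (- (norm w)\<^sup>2 / 2))
     = (\<Prod>b\<in>Basis. exp (\<i> * complex_of_real ((w \<bullet> b) * (v \<bullet> b))) * complex_of_real (exp (- (w \<bullet> b)\<^sup>2 / 2)))" for w :: 'a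
    unfolding prod.distrib of_real_prod[symmetric] exp_sum[OF finite_Basis, symmetric] sum_distrib_left[symmetric] of_real_sum[symmetric]
      euclidean_inner[of w v, symmetric]
    by (simp add: nrm sum_divide_distrib[symmetric] sum_negf)
  then have "(LINT w|lborel. exp (\<i> * complex_of_real (w \<bullet> v)) * complex_of_real (exp (- (norm w)\<^sup>2 / 2)))
     = (\<Prod>b\<in>(Basis :: 'a set). complex_of_real (sqrt (2 * pi) * exp (- (v \<bullet> b)\<^sup>2 / 2)))"
    using lborel_integral_prod_Basis[of "\<lambda>b::'a. \<lambda>t. exp (\<i> * complex_of_real (t * (v \<bullet> b))) * complex_of_real (exp (- t\<^sup>2 / 2))"]
      gaussian_fourier_transform_real by simp
  also have "\<dots> = complex_of_real (sqrt (2 * pi) ^ DIM('a) * exp (- (norm v)\<^sup>2 / 2))"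
    unfolding of_real_prod[symmetric] prod.distrib exp_sum[OF finite_Basis, symmetric]
    by (simp add: nrm sum_divide_distrib[symmetric] sum_negf)
  also have "sqrt (2 * pi) ^ DIM('a) = (2 * pi) powr (real DIM('a) / 2)"
    by (simp add: powr_half_sqrt[symmetric] powr_powr powr_realpow[symmetric])
  finally show ?thesis .
qed

text \<open>By \<open>(1 + t)^K \<le> K! exp (1 + t)\<close> and completing the square: \<open>1 + t - t^2 / 2 = 3 / 2 - (t - 1)^2 / 2\<close>.\<close>

lemma gaussian_rapid_decay:
  fixes t :: real
  assumes "0 \<le> t"
  shows "(1 + t) ^ K * exp (- t\<^sup>2 / 2) \<le> fact K * exp (3 / 2)"
proof -
  have "(1 + t) ^ K / fact K \<le> exp (1 + t)"
    using assms sum_le_suminf[OF summable_exp[of "1 + t"], of "{K}"]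
    by (simp add: exp_def field_simps)
  then have "(1 + t) ^ K * exp (- t\<^sup>2 / 2) \<le> (fact K * exp (1 + t)) * exp (- t\<^sup>2 / 2)"
    by (intro mult_right_mono) (auto simp: field_simps)
  also have "\<dots> = fact K * exp (1 + t - t\<^sup>2 / 2)"
    by (simp add: exp_add[symmetric])
  also have "\<dots> \<le> fact K * exp (3 / 2)"
  proof -
    have "0 \<le> (t - 1)\<^sup>2" by simp
    then show ?thesis by (simp add: power2_eq_square algebra_simps)
  qed
  finally show ?thesis .
qed

lemma integrable_power_gaussian:
  "integrable lborel (\<lambda>w::real ^ 'n::finite. (1 + norm w) ^ K * exp (- (norm w)\<^sup>2 / 2))"
proof -
  have "integrable lborel (\<lambda>w::real ^ 'n. complex_of_real ((1 + norm w) ^ K * exp (- (norm w)\<^sup>2 / 2)))"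
  proof (rule integrable_rapid(1))
    show "continuous_on UNIV (\<lambda>w::real ^ 'n. complex_of_real ((1 + norm w) ^ K * exp (- (norm w)\<^sup>2 / 2)))"
      by (intro continuous_intros) auto
    fix w :: "real ^ 'n"
    have "cmod (complex_of_real ((1 + norm w) ^ K * exp (- (norm w)\<^sup>2 / 2))) = (1 + norm w) ^ K * exp (- (norm w)\<^sup>2 / 2)"
      unfolding norm_of_real by simp
    then show "(1 + norm w) ^ (2 * CARD('n)) * cmod (complex_of_real ((1 + norm w) ^ K * exp (- (norm w)\<^sup>2 / 2)))
      \<le> fact (2 * CARD('n) + K) * exp (3 / 2)"
      using gaussian_rapid_decay[of "norm w" "2 * CARD('n) + K"]
      by (simp only: power_add mult.assoc norm_ge_zero)
  qed
  then show ?thesis by (simp only: complex_of_real_integrable_eq)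
qed

text \<open>Averaging the transform over frequencies \<open>\<xi> + \<rho> w\<close> with Gaussian weight localises the defining integral
  to distance \<open>1 / \<rho>\<close> from the point \<open>x + v\<^sub>0\<close>: by Fubini the integral over \<open>w\<close> is the Fourier transform
  of a Gaussian. This plays the role of Fourier inversion.\<close>

lemma gaussian_average_of_STFT:
  fixes \<phi> :: "real ^ 'n::finite \<Rightarrow> real" and \<rho> :: real
  assumes \<phi>: "continuous_on UNIV \<phi>" and \<psi>: "\<psi> \<in> schwartz_space" and \<rho>: "0 < \<rho>"
  shows "(\<lambda>w. STFT \<psi> (distribution_of (\<lambda>y. exp (\<i> * complex_of_real (\<phi> y)))) x (\<xi> + \<rho> *\<^sub>R w)) \<in> borel_measurable lborel"
    and "(LINT w|lborel. complex_of_real (\<rho> ^ CARD('n)) * (exp (\<i> * complex_of_real ((x + v\<^sub>0) \<bullet> (\<xi> + \<rho> *\<^sub>R w)))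
        * STFT \<psi> (distribution_of (\<lambda>y. exp (\<i> * complex_of_real (\<phi> y)))) x (\<xi> + \<rho> *\<^sub>R w)
        * complex_of_real (exp (- (norm w)\<^sup>2 / 2))))
     = (LINT s|lborel. exp (\<i> * complex_of_real (\<phi> (x + v\<^sub>0 + s /\<^sub>R \<rho>) - (s /\<^sub>R \<rho>) \<bullet> \<xi>)) * cnj (\<psi> (v\<^sub>0 + s /\<^sub>R \<rho>))
        * complex_of_real (exp (- (norm s)\<^sup>2 / 2)))"
proof -
  let ?V = "STFT \<psi> (distribution_of (\<lambda>y. exp (\<i> * complex_of_real (\<phi> y))))"
  let ?K = "complex_of_real ((2 * pi) powr (- real CARD('n) / 2))"
  define F :: "real ^ 'n \<Rightarrow> real ^ 'n \<Rightarrow> complex" where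
    "F w v = exp (\<i> * complex_of_real (\<phi> (x + v) - (v - v\<^sub>0) \<bullet> (\<xi> + \<rho> *\<^sub>R w))) * cnj (\<psi> v)
       * complex_of_real (exp (- (norm w)\<^sup>2 / 2))" for w v
  note \<psi>c = schwartz_continuous[OF \<psi>]
  have Fc: "continuous_on UNIV (case_prod F)"
    unfolding F_def case_prod_unfold
    by (intro continuous_intros continuous_on_compose2[OF \<phi>] continuous_on_compose2[OF \<psi>c]) auto
  have Fm: "case_prod F \<in> borel_measurable (lborel \<Otimes>\<^sub>M lborel)"
    using Fc unfolding lborel_prod by (simp add: borel_measurable_continuous_onI)
  have \<psi>i: "integrable lborel (\<lambda>v. cmod (\<psi> v))"
    using integrable_bounded_times_schwartz(1)[of "\<lambda>_. 1" 1 \<psi>] \<psi> integrable_norm by force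
  have nF: "cmod (F w v) = cmod (\<psi> v) * exp (- (norm w)\<^sup>2 / 2)" for w v
    by (simp add: F_def norm_mult)
  have Fi: "integrable (lborel \<Otimes>\<^sub>M lborel) (case_prod F)"
  proof (rule lborel_pair.Fubini_integrable[OF Fm])
    show "integrable lborel (\<lambda>w. LINT v|lborel. norm (case_prod F (w, v)))"
      using integrable_power_gaussian[where K = 0 and 'n = 'n] by (simp add: nF)
    have "integrable lborel (F w)" for w
    proof (rule Bochner_Integration.integrable_bound)
      show "integrable lborel (\<lambda>v. cmod (\<psi> v) * exp (- (norm w)\<^sup>2 / 2))"
        by (intro integrable_mult_left \<psi>i)
      have "continuous_on UNIV (F w)"
        unfolding F_def by (intro continuous_intros continuous_on_compose2[OF \<phi>] \<psi>c) auto
      then show "F w \<in> borel_measurable lborel" by (simp add: borel_measurable_continuous_onI)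
    qed (simp add: nF)
    then show "AE w in lborel. integrable lborel (\<lambda>v. case_prod F (w, v))" by simp
  qed
  have VF: "exp (\<i> * complex_of_real ((x + v\<^sub>0) \<bullet> (\<xi> + \<rho> *\<^sub>R w))) * ?V x (\<xi> + \<rho> *\<^sub>R w)
      * complex_of_real (exp (- (norm w)\<^sup>2 / 2)) = ?K * (LINT v|lborel. F w v)" for w
  proof -
    let ?\<eta> = "\<xi> + \<rho> *\<^sub>R w"
    have e: "exp (\<i> * complex_of_real ((x + v\<^sub>0) \<bullet> ?\<eta>)) * exp (- (\<i> * complex_of_real (x \<bullet> ?\<eta>))) = exp (\<i> * complex_of_real (v\<^sub>0 \<bullet> ?\<eta>))"
      unfolding exp_add[symmetric] by (rule arg_cong[of _ _ exp]) (simp add: inner_add_left algebra_simps)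
    have e': "exp (\<i> * complex_of_real (v\<^sub>0 \<bullet> ?\<eta>)) * exp (\<i> * complex_of_real (\<phi> (x + v) - v \<bullet> ?\<eta>))
       = exp (\<i> * complex_of_real (\<phi> (x + v) - (v - v\<^sub>0) \<bullet> ?\<eta>))" for v
      unfolding exp_add[symmetric] by (rule arg_cong[of _ _ exp]) (simp add: inner_diff_left algebra_simps)
    have "exp (\<i> * complex_of_real ((x + v\<^sub>0) \<bullet> ?\<eta>)) * ?V x ?\<eta> * complex_of_real (exp (- (norm w)\<^sup>2 / 2))
      = ?K * ((exp (\<i> * complex_of_real ((x + v\<^sub>0) \<bullet> ?\<eta>)) * exp (- (\<i> * complex_of_real (x \<bullet> ?\<eta>))))
         * (LINT v|lborel. exp (\<i> * complex_of_real (\<phi> (x + v) - v \<bullet> ?\<eta>)) * cnj (\<psi> v)) * complex_of_real (exp (- (norm w)\<^sup>2 / 2)))"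
      unfolding STFT_of_phase[OF \<phi> \<psi>] by (simp only: mult_ac)
    also have "\<dots> = ?K * (LINT v|lborel. F w v)"
      unfolding e integral_mult_right_zero[symmetric] integral_mult_left_zero[symmetric]
      unfolding F_def e'[symmetric] by (simp only: mult_ac)
    finally show ?thesis .
  qed
  have Vm: "(\<lambda>w. ?K * (LINT v|lborel. F w v)) \<in> borel_measurable lborel"
    using Fm by (intro borel_measurable_times borel_measurable_const lborel.borel_measurable_lebesgue_integral)
  have "?V x (\<xi> + \<rho> *\<^sub>R w) = exp (- (\<i> * complex_of_real ((x + v\<^sub>0) \<bullet> (\<xi> + \<rho> *\<^sub>R w))))
     * complex_of_real (exp ((norm w)\<^sup>2 / 2)) * (?K * (LINT v|lborel. F w v))" for w
    unfolding VF[symmetric] by (simp add: exp_minus field_simps flip: of_real_mult exp_add)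
  moreover have "(\<lambda>w. exp (- (\<i> * complex_of_real ((x + v\<^sub>0) \<bullet> (\<xi> + \<rho> *\<^sub>R w))))
     * complex_of_real (exp ((norm w)\<^sup>2 / 2)) * (?K * (LINT v|lborel. F w v))) \<in> borel_measurable lborel"
    by (intro borel_measurable_times[OF _ Vm])
      (unfold measurable_lborel2, (intro borel_measurable_continuous_onI continuous_intros; simp))
  ultimately show "(\<lambda>w. ?V x (\<xi> + \<rho> *\<^sub>R w)) \<in> borel_measurable lborel" by (simp only:)
  define H where "H v = exp (\<i> * complex_of_real (\<phi> (x + v) - (v - v\<^sub>0) \<bullet> \<xi>)) * cnj (\<psi> v)
      * complex_of_real (exp (- (norm (\<rho> *\<^sub>R (v - v\<^sub>0)))\<^sup>2 / 2))" for v
  have Hm: "H \<in> borel_measurable borel"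
    unfolding H_def
    by (intro borel_measurable_continuous_onI continuous_intros continuous_on_compose2[OF \<phi>] \<psi>c) auto
  have FH: "(LINT w|lborel. F w v) = complex_of_real ((2 * pi) powr (real CARD('n) / 2)) * H v" for v
  proof -
    have e: "exp (\<i> * complex_of_real (\<phi> (x + v) - (v - v\<^sub>0) \<bullet> (\<xi> + \<rho> *\<^sub>R w)))
      = exp (\<i> * complex_of_real (\<phi> (x + v) - (v - v\<^sub>0) \<bullet> \<xi>)) * exp (\<i> * complex_of_real (w \<bullet> (- (\<rho> *\<^sub>R (v - v\<^sub>0)))))" for w
      unfolding exp_add[symmetric]
      by (rule arg_cong[of _ _ exp]) (simp add: inner_add_right inner_commute[of w] algebra_simps)
    have "(LINT w|lborel. F w v) = (LINT w|lborel. exp (\<i> * complex_of_real (\<phi> (x + v) - (v - v\<^sub>0) \<bullet> \<xi>)) * cnj (\<psi> v)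
       * (exp (\<i> * complex_of_real (w \<bullet> (- (\<rho> *\<^sub>R (v - v\<^sub>0))))) * complex_of_real (exp (- (norm w)\<^sup>2 / 2))))"
      unfolding F_def e by (simp only: mult_ac)
    also have "\<dots> = exp (\<i> * complex_of_real (\<phi> (x + v) - (v - v\<^sub>0) \<bullet> \<xi>)) * cnj (\<psi> v)
       * complex_of_real ((2 * pi) powr (real CARD('n) / 2) * exp (- (norm (- (\<rho> *\<^sub>R (v - v\<^sub>0))))\<^sup>2 / 2))"
      unfolding integral_mult_right_zero gaussian_fourier_transform by simp
    also have "\<dots> = complex_of_real ((2 * pi) powr (real CARD('n) / 2)) * H v"
      unfolding H_def norm_minus_cancel of_real_mult by (simp only: mult_ac)
    finally show ?thesis .
  qed
  have KK: "?K * complex_of_real ((2 * pi) powr (real CARD('n) / 2)) = 1"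
    unfolding of_real_mult[symmetric] powr_add[symmetric] by simp
  have "(LINT w|lborel. complex_of_real (\<rho> ^ CARD('n)) * (exp (\<i> * complex_of_real ((x + v\<^sub>0) \<bullet> (\<xi> + \<rho> *\<^sub>R w)))
        * ?V x (\<xi> + \<rho> *\<^sub>R w) * complex_of_real (exp (- (norm w)\<^sup>2 / 2))))
     = complex_of_real (\<rho> ^ CARD('n)) * (?K * (LINT w|lborel. LINT v|lborel. F w v))"
    unfolding VF integral_mult_right_zero ..
  also have "(LINT w|lborel. LINT v|lborel. F w v) = (LINT v|lborel. LINT w|lborel. F w v)"
    using lborel_pair.Fubini_integral[OF Fi] by simp
  also have "\<dots> = complex_of_real ((2 * pi) powr (real CARD('n) / 2)) * (LINT v|lborel. H v)"
    unfolding FH integral_mult_right_zero ..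
  also have "?K * (complex_of_real ((2 * pi) powr (real CARD('n) / 2)) * (LINT v|lborel. H v)) = (LINT v|lborel. H v)"
    unfolding mult.assoc[symmetric] KK by simp
  also have "(LINT v|lborel. H v) = (1 / \<rho>) ^ CARD('n) *\<^sub>R (LINT s|lborel. H (v\<^sub>0 + (1 / \<rho>) *\<^sub>R s))"
    using lborel_integral_affine[OF Hm, of "1 / \<rho>" v\<^sub>0] \<rho> by simp
  also have "complex_of_real (\<rho> ^ CARD('n)) * ((1 / \<rho>) ^ CARD('n) *\<^sub>R (LINT s|lborel. H (v\<^sub>0 + (1 / \<rho>) *\<^sub>R s)))
     = (LINT s|lborel. H (v\<^sub>0 + (1 / \<rho>) *\<^sub>R s))"
    using \<rho> by (simp add: scaleR_conv_of_real power_divide)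
  also have "\<dots> = (LINT s|lborel. exp (\<i> * complex_of_real (\<phi> (x + v\<^sub>0 + s /\<^sub>R \<rho>) - (s /\<^sub>R \<rho>) \<bullet> \<xi>)) * cnj (\<psi> (v\<^sub>0 + s /\<^sub>R \<rho>))
        * complex_of_real (exp (- (norm s)\<^sup>2 / 2)))"
  proof -
    have z: "(1 / \<rho>) *\<^sub>R s = s /\<^sub>R \<rho>" "\<rho> *\<^sub>R (s /\<^sub>R \<rho>) = s" for s :: "real ^ 'n"
      using \<rho> by (simp_all add: inverse_eq_divide)
    show ?thesis
      unfolding H_def z(1) add_diff_cancel_left' z(2) add.assoc ..
  qed
  finally show "(LINT w|lborel. complex_of_real (\<rho> ^ CARD('n)) * (exp (\<i> * complex_of_real ((x + v\<^sub>0) \<bullet> (\<xi> + \<rho> *\<^sub>R w)))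
        * ?V x (\<xi> + \<rho> *\<^sub>R w) * complex_of_real (exp (- (norm w)\<^sup>2 / 2))))
     = (LINT s|lborel. exp (\<i> * complex_of_real (\<phi> (x + v\<^sub>0 + s /\<^sub>R \<rho>) - (s /\<^sub>R \<rho>) \<bullet> \<xi>)) * cnj (\<psi> (v\<^sub>0 + s /\<^sub>R \<rho>))
        * complex_of_real (exp (- (norm s)\<^sup>2 / 2)))" .
qed

section \<open>The wave front set of a polynomial phase\<close>

text \<open>Suppose that the transform decays rapidly near \<open>(x, \<nabla>\<phi>\<^sub>m(x))\<close>. Let \<open>l = \<kappa>^2\<close>, \<open>\<rho> = \<kappa>^(2 m - 3)\<close> and let \<open>\<xi>\<close> be the
  gradient of \<open>\<phi>\<close> at \<open>l x + v\<^sub>0\<close>, where the window does not vanish at \<open>v\<^sub>0\<close>. The Gaussian average of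
  the transform over the frequencies \<open>\<xi> + \<rho> w\<close> is computed in two ways.

  In frequency, \<open>\<rho>\<close> is smaller than the scale \<open>l^(m - 1) = \<rho> \<kappa>\<close>, so for \<open>w\<close> small against \<open>\<kappa>\<close>
  the point stays in the region of rapid decay, while for large \<open>w\<close> the Gaussian beats every power of \<open>\<kappa>\<close>. The
  average tends to zero.

  In space, the integrand lives at distance \<open>1 / \<rho>\<close> from \<open>l x + v\<^sub>0\<close>. There the gradient
  of the phase varies by \<open>O(l^(m - 2))\<close>, and \<open>l^(m - 2) / \<rho> = 1 / \<kappa>\<close>, so that the phase is constant in the limit. The
  average tends, up to a unimodular factor, to a nonzero multiple of the conjugate of \<open>\<psi> v\<^sub>0\<close>.\<close>

theorem in_WFg_on_gradient:
  fixes c :: "('n::finite \<Rightarrow> nat) \<Rightarrow> real" and \<psi> :: "real ^ 'n \<Rightarrow> complex"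
  assumes m: "m \<ge> 2" and \<psi>: "\<psi> \<in> schwartz_space" "\<psi> \<noteq> (\<lambda>x. 0)" and x: "x \<noteq> 0"
  shows "(x, mi_poly_grad {\<alpha>. mi_order \<alpha> = m} c x) \<in> WFg (real m - 1) \<psi>
    (distribution_of (\<lambda>y. exp (\<i> * complex_of_real (mi_poly {\<alpha>. mi_order \<alpha> \<le> m} c y))))"
proof (rule ccontr)
  let ?A = "{\<alpha> :: 'n \<Rightarrow> nat. mi_order \<alpha> \<le> m}" and ?E = "{\<alpha> :: 'n \<Rightarrow> nat. mi_order \<alpha> = m}"
  let ?d = "CARD('n)"
  define \<phi> where "\<phi> = mi_poly ?A c"
  define G where "G = mi_poly_grad ?A c"
  define \<xi>\<^sub>0 where "\<xi>\<^sub>0 = mi_poly_grad ?E c x"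
  define V where "V = STFT \<psi> (distribution_of (\<lambda>y. exp (\<i> * complex_of_real (\<phi> y))))"
  have \<phi>: "continuous_on UNIV \<phi>" unfolding \<phi>_def by (rule continuous_mi_poly)
  have grad: "GDERIV \<phi> z :> G z" for z unfolding \<phi>_def G_def by (rule GDERIV_mi_poly)
  assume "(x, mi_poly_grad ?E c x) \<notin> WFg (real m - 1) \<psi>
    (distribution_of (\<lambda>y. exp (\<i> * complex_of_real (mi_poly ?A c y))))"
  with x obtain U where U: "open U" "(x, \<xi>\<^sub>0) \<in> U" and
    bdd: "\<And>N. bdd_above {l ^ N * cmod (V (l *\<^sub>R x) ((l powr (real m - 1)) *\<^sub>R \<xi>)) | x \<xi> l. (x, \<xi>) \<in> U \<and> 0 < l}"
    unfolding WFg_def \<xi>\<^sub>0_def V_def \<phi>_def zero_prod_def by blast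
  from U obtain \<epsilon> where \<epsilon>: "0 < \<epsilon>" "\<And>\<eta>. dist \<eta> \<xi>\<^sub>0 < \<epsilon> \<Longrightarrow> (x, \<eta>) \<in> U"
    by (auto simp: open_dist dist_Pair_Pair dest!: bspec)
  obtain v\<^sub>0 where v0: "\<psi> v\<^sub>0 \<noteq> 0" using \<psi>(2) by auto
  obtain C where C: "0 \<le> C" "\<And>l z y. norm z \<le> norm x \<Longrightarrow> 1 \<le> l \<Longrightarrow>
      norm (G (l *\<^sub>R z + y) - l ^ (m - 1) *\<^sub>R mi_poly_grad ?E c z) \<le> C * l ^ (m - 2) * (1 + norm y) ^ (m - 1)"
    using mi_poly_grad_asymptotics[OF m, of "norm x" c] unfolding G_def by blast
  have C': "norm (G (l *\<^sub>R x + y) - l ^ (m - 1) *\<^sub>R \<xi>\<^sub>0) \<le> C * l ^ (m - 2) * (1 + norm y) ^ (m - 1)" if "1 \<le> l" for l y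
    using C(2)[OF order_refl that] unfolding \<xi>\<^sub>0_def .
  define q where "q = 2 * m - 3"
  define \<kappa> where "\<kappa> k = real (Suc k)" for k
  define X where "X k = (\<kappa> k)\<^sup>2 *\<^sub>R x" for k
  define \<rho> where "\<rho> k = \<kappa> k ^ q" for k
  define \<xi> where "\<xi> k = G (X k + v\<^sub>0)" for k
  have \<kappa>: "1 \<le> \<kappa> k" "0 < \<kappa> k" for k by (auto simp: \<kappa>_def)
  have \<rho>: "1 \<le> \<rho> k" "0 < \<rho> k" for k using \<kappa> by (auto simp: \<rho>_def)
  have inv\<kappa>: "(\<lambda>k. inverse (\<kappa> k)) \<longlonglongrightarrow> 0" unfolding \<kappa>_def by (rule LIMSEQ_inverse_real_of_nat)
  have pow1: "((\<kappa> k)\<^sup>2) ^ (m - 2) * \<kappa> k = \<rho> k" for k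
  proof -
    have "Suc (2 * (m - 2)) = q" using m by (simp add: q_def)
    then show ?thesis unfolding \<rho>_def power_mult[symmetric] by (metis power_Suc2)
  qed
  have pow2: "\<rho> k * \<kappa> k = ((\<kappa> k)\<^sup>2) ^ (m - 1)" for k
  proof -
    have "Suc q = 2 * (m - 1)" using m by (simp add: q_def)
    then show ?thesis unfolding \<rho>_def power_mult[symmetric] by (metis power_Suc2)
  qed

  \<comment> \<open>The average in the frequency variable \<open>w\<close> and in the space variable \<open>s\<close>.\<close>
  define a where "a k w = complex_of_real (\<rho> k ^ ?d) * (exp (\<i> * complex_of_real ((X k + v\<^sub>0) \<bullet> (\<xi> k + \<rho> k *\<^sub>R w)))
      * V (X k) (\<xi> k + \<rho> k *\<^sub>R w) * complex_of_real (exp (- (norm w)\<^sup>2 / 2)))" for k w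
  define b where "b k s = exp (\<i> * complex_of_real (\<phi> (X k + v\<^sub>0 + s /\<^sub>R \<rho> k) - (s /\<^sub>R \<rho> k) \<bullet> \<xi> k)) * cnj (\<psi> (v\<^sub>0 + s /\<^sub>R \<rho> k))
        * complex_of_real (exp (- (norm s)\<^sup>2 / 2))" for k s
  have ab: "(LINT w|lborel. a k w) = (LINT s|lborel. b k s)" for k
    unfolding a_def b_def V_def by (rule gaussian_average_of_STFT(2)[OF \<phi> \<psi>(1) \<rho>(2)])

  \<comment> \<open>The frequency side tends to zero.\<close>
  have "(\<lambda>k. LINT w|lborel. a k w) \<longlonglongrightarrow> (LINT w::real ^ 'n|lborel. 0)"
  proof -
    define C1 where "C1 = C * (1 + norm v\<^sub>0) ^ (m - 1)"
    have C1: "0 \<le> C1" using C(1) by (simp add: C1_def)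
    \<comment> \<open>Normalising the Gaussian costs \<open>\<rho>^d = \<kappa>^(q d)\<close>; one further power of \<open>\<kappa>\<close> gives the limit zero.\<close>
    define N where "N = q * ?d + 1"
    obtain B where B: "\<And>\<eta> l. (x, \<eta>) \<in> U \<Longrightarrow> 0 < l \<Longrightarrow> l ^ N * cmod (V (l *\<^sub>R x) ((l powr (real m - 1)) *\<^sub>R \<eta>)) \<le> B"
      using bdd[of N] unfolding bdd_above_def by blast
    obtain B' where B': "0 \<le> B'" "\<And>x \<xi>. cmod (V x \<xi>) \<le> B'"
      using STFT_of_phase_bounded[OF \<phi> \<psi>(1)] unfolding V_def by blast
    have near: "\<rho> k ^ ?d * cmod (V (X k) (\<xi> k + \<rho> k *\<^sub>R w)) \<le> \<bar>B\<bar> * inverse (\<kappa> k)"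
      if w: "C1 + norm w < \<epsilon> * \<kappa> k" for k w
    proof -
      define L where "L = (\<kappa> k)\<^sup>2"
      have L: "1 \<le> L" "0 < L" using \<kappa>[of k] by (auto simp: L_def)
      define \<eta> where "\<eta> = (\<xi> k + \<rho> k *\<^sub>R w) /\<^sub>R L ^ (m - 1)"
      have "norm (\<xi> k + \<rho> k *\<^sub>R w - L ^ (m - 1) *\<^sub>R \<xi>\<^sub>0) \<le> norm (\<xi> k - L ^ (m - 1) *\<^sub>R \<xi>\<^sub>0) + norm (\<rho> k *\<^sub>R w)"
        using norm_triangle_ineq[of "\<xi> k - L ^ (m - 1) *\<^sub>R \<xi>\<^sub>0" "\<rho> k *\<^sub>R w"] by (simp add: algebra_simps)
      also have "\<dots> \<le> C1 * L ^ (m - 2) + \<rho> k * norm w"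
        using C'[OF L(1), of v\<^sub>0] \<rho>[of k] by (simp add: \<xi>_def X_def L_def C1_def mult_ac)
      also have "\<dots> \<le> C1 * \<rho> k + \<rho> k * norm w"
      proof -
        have "L ^ (m - 2) * 1 \<le> L ^ (m - 2) * \<kappa> k" using \<kappa>[of k] L by (intro mult_left_mono) auto
        then show ?thesis using pow1[of k] C1 by (simp add: L_def mult_left_mono)
      qed
      also have "\<dots> = \<rho> k * (C1 + norm w)" by (simp add: algebra_simps)
      also have "\<dots> < \<rho> k * (\<epsilon> * \<kappa> k)" using w \<rho>[of k] by simp
      also have "\<dots> = \<epsilon> * L ^ (m - 1)" using pow2[of k] by (simp add: L_def mult_ac)
      finally have lt: "norm (\<xi> k + \<rho> k *\<^sub>R w - L ^ (m - 1) *\<^sub>R \<xi>\<^sub>0) < \<epsilon> * L ^ (m - 1)" .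
      have Lp: "0 < L ^ (m - 1)" using L by simp
      have "\<eta> - \<xi>\<^sub>0 = (\<xi> k + \<rho> k *\<^sub>R w - L ^ (m - 1) *\<^sub>R \<xi>\<^sub>0) /\<^sub>R L ^ (m - 1)"
        by (simp only: \<eta>_def scaleR_diff_right scaleR_scaleR left_inverse[OF less_imp_neq[OF Lp, symmetric]] scaleR_one)
      then have "dist \<eta> \<xi>\<^sub>0 = norm (\<xi> k + \<rho> k *\<^sub>R w - L ^ (m - 1) *\<^sub>R \<xi>\<^sub>0) / L ^ (m - 1)"
        using Lp by (simp add: dist_norm divide_inverse mult.commute)
      also have "\<dots> < \<epsilon>" using lt Lp by (simp only: pos_divide_less_eq)
      finally have "(x, \<eta>) \<in> U" by (rule \<epsilon>(2))
      moreover have "L powr (real m - 1) = L ^ (m - 1)"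
        using L m by (simp add: powr_realpow[symmetric] of_nat_diff)
      moreover have "L ^ (m - 1) *\<^sub>R \<eta> = \<xi> k + \<rho> k *\<^sub>R w"
        by (simp only: \<eta>_def scaleR_scaleR right_inverse[OF less_imp_neq[OF Lp, symmetric]] scaleR_one)
      ultimately have 1: "L ^ N * cmod (V (X k) (\<xi> k + \<rho> k *\<^sub>R w)) \<le> B"
        using B[of \<eta> L] L by (simp add: X_def L_def)
      have "\<kappa> k * \<rho> k ^ ?d = \<kappa> k ^ N"
        by (simp add: \<rho>_def N_def power_mult[symmetric])
      also have "\<dots> \<le> L ^ N"
        using \<kappa>[of k] by (intro power_mono) (auto simp: L_def power2_eq_square)
      finally have "\<kappa> k * \<rho> k ^ ?d * cmod (V (X k) (\<xi> k + \<rho> k *\<^sub>R w)) \<le> L ^ N * cmod (V (X k) (\<xi> k + \<rho> k *\<^sub>R w))"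
        by (intro mult_right_mono) auto
      with 1 have "\<kappa> k * (\<rho> k ^ ?d * cmod (V (X k) (\<xi> k + \<rho> k *\<^sub>R w))) \<le> \<bar>B\<bar>" by (simp add: mult.assoc)
      then show ?thesis using \<kappa>[of k] by (simp add: field_simps)
    qed
    define M where "M = \<bar>B\<bar> + B' * ((C1 + 1) / \<epsilon>) ^ (q * ?d)"
    have dom: "\<rho> k ^ ?d * cmod (V (X k) (\<xi> k + \<rho> k *\<^sub>R w)) \<le> M * (1 + norm w) ^ (q * ?d)" for k w
    proof (cases "C1 + norm w < \<epsilon> * \<kappa> k")
      case True
      have "\<bar>B\<bar> * inverse (\<kappa> k) \<le> \<bar>B\<bar> * 1"
        using \<kappa>[of k] by (intro mult_left_mono) (auto simp: field_simps)
      also have "\<dots> \<le> M * 1" using B'(1) C1 \<epsilon>(1) by (simp add: M_def)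
      also have "\<dots> \<le> M * (1 + norm w) ^ (q * ?d)"
        using B'(1) C1 \<epsilon>(1) by (intro mult_left_mono one_le_power) (auto simp: M_def)
      finally show ?thesis using near[OF True] by linarith
    next
      case False
      have "\<epsilon> * \<kappa> k \<le> C1 + norm w" using False by simp
      also have "\<dots> \<le> (C1 + 1) * (1 + norm w)" using C1 by (simp add: algebra_simps)
      finally have "\<kappa> k \<le> (C1 + 1) / \<epsilon> * (1 + norm w)" using \<epsilon>(1) by (simp add: field_simps)
      then have "\<kappa> k ^ (q * ?d) \<le> ((C1 + 1) / \<epsilon> * (1 + norm w)) ^ (q * ?d)"
        using \<kappa>[of k] by (intro power_mono) auto
      then have "\<rho> k ^ ?d * cmod (V (X k) (\<xi> k + \<rho> k *\<^sub>R w)) \<le> ((C1 + 1) / \<epsilon> * (1 + norm w)) ^ (q * ?d) * B'"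
        using B'(2) \<rho>[of k] C1 \<epsilon>(1) by (intro mult_mono) (auto simp: \<rho>_def power_mult)
      also have "\<dots> = (B' * ((C1 + 1) / \<epsilon>) ^ (q * ?d)) * (1 + norm w) ^ (q * ?d)"
        by (simp only: power_mult_distrib mult_ac)
      also have "\<dots> \<le> M * (1 + norm w) ^ (q * ?d)"
        by (intro mult_right_mono) (auto simp: M_def)
      finally show ?thesis .
    qed
    have na: "norm (a k w) = \<rho> k ^ ?d * cmod (V (X k) (\<xi> k + \<rho> k *\<^sub>R w)) * exp (- (norm w)\<^sup>2 / 2)" for k w
      using \<rho>(2)[of k] by (simp add: a_def norm_mult norm_power)
    show ?thesis
    proof (rule integral_dominated_convergence)
      show "integrable lborel (\<lambda>w::real ^ 'n. M * ((1 + norm w) ^ (q * ?d) * exp (- (norm w)\<^sup>2 / 2)))"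
        by (intro integrable_mult_right integrable_power_gaussian)
      show "AE w in lborel. norm (a k w) \<le> M * ((1 + norm w) ^ (q * ?d) * exp (- (norm w)\<^sup>2 / 2))" for k
        unfolding na mult.assoc[symmetric] by (intro AE_I2 mult_right_mono dom) auto
      show "a k \<in> borel_measurable lborel" for k
        unfolding a_def V_def
        by (intro borel_measurable_times gaussian_average_of_STFT(1)[OF \<phi> \<psi>(1) \<rho>(2)])
          (unfold measurable_lborel2, (intro borel_measurable_continuous_onI continuous_intros; simp)+)
      show "AE w in lborel. (\<lambda>k. a k w) \<longlonglongrightarrow> 0"
      proof (rule AE_I2, rule Lim_null_comparison)
        fix w :: "real ^ 'n"
        have "filterlim (\<lambda>k. \<epsilon> * \<kappa> k) at_top sequentially"
          unfolding \<kappa>_def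
          by (intro filterlim_tendsto_pos_mult_at_top[OF tendsto_const \<epsilon>(1)]
            filterlim_compose[OF filterlim_real_sequentially filterlim_Suc])
        then have "\<forall>\<^sub>F k in sequentially. C1 + norm w < \<epsilon> * \<kappa> k"
          by (simp add: filterlim_at_top_dense)
        then show "\<forall>\<^sub>F k in sequentially. norm (a k w) \<le> \<bar>B\<bar> * inverse (\<kappa> k)"
        proof eventually_elim
          case (elim k)
          have "norm (a k w) \<le> (\<bar>B\<bar> * inverse (\<kappa> k)) * 1"
            unfolding na using \<kappa>[of k] \<rho>[of k] by (intro mult_mono near[OF elim]) auto
          then show ?case by simp
        qed
        show "(\<lambda>k. \<bar>B\<bar> * inverse (\<kappa> k)) \<longlonglongrightarrow> 0"
          by (rule tendsto_mult_right_zero[OF inv\<kappa>])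
      qed
    qed simp
  qed
  then have a0: "(\<lambda>k. norm (LINT w|lborel. a k w)) \<longlonglongrightarrow> 0"
    using tendsto_norm_zero by fastforce

  \<comment> \<open>The space side, freed from its unimodular factor, has a nonzero limit.\<close>
  let ?b = "\<lambda>k s. exp (- (\<i> * complex_of_real (\<phi> (X k + v\<^sub>0)))) * b k s"
  let ?lim = "\<lambda>s :: real ^ 'n. cnj (\<psi> v\<^sub>0) * complex_of_real (exp (- (norm s)\<^sup>2 / 2))"
  obtain D where D: "\<And>v. cmod (\<psi> v) \<le> D"
    using schwartz_bound[OF \<psi>(1), of 0 "[]"] by auto
  have blim: "(\<lambda>k. LINT s|lborel. ?b k s) \<longlonglongrightarrow> (LINT s|lborel. ?lim s)"
  proof (rule integral_dominated_convergence)
    show "integrable lborel (\<lambda>s::real ^ 'n. D * exp (- (norm s)\<^sup>2 / 2))"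
      using integrable_power_gaussian[where K = 0 and 'n = 'n] by simp
    show "AE s in lborel. norm (?b k s) \<le> D * exp (- (norm s)\<^sup>2 / 2)" for k
      by (intro AE_I2) (auto simp: b_def norm_mult intro!: mult_right_mono D)
    show "?lim \<in> borel_measurable lborel"
      by (unfold measurable_lborel2, (intro borel_measurable_continuous_onI continuous_intros; simp))
    show "?b k \<in> borel_measurable lborel" for k
      unfolding b_def
      by (unfold measurable_lborel2, intro borel_measurable_continuous_onI continuous_intros continuous_on_compose2[OF \<phi>]
          continuous_on_compose2[OF schwartz_continuous[OF \<psi>(1)]]) auto
    show "AE s in lborel. (\<lambda>k. ?b k s) \<longlonglongrightarrow> ?lim s"
    proof (rule AE_I2)
      fix s :: "real ^ 'n"
      \<comment> \<open>The remainder of the linear Taylor expansion of the phase at \<open>X k + v\<^sub>0\<close>.\<close>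
      define \<theta> where "\<theta> k = \<phi> (X k + v\<^sub>0 + s /\<^sub>R \<rho> k) - (s /\<^sub>R \<rho> k) \<bullet> \<xi> k - \<phi> (X k + v\<^sub>0)" for k
      let ?W = "(1 + (norm v\<^sub>0 + norm s)) ^ (m - 1)"
      have s\<rho>: "norm (s /\<^sub>R \<rho> k) \<le> norm s" for k
        using \<rho>[of k] by (simp add: field_simps mult_le_cancel_left1)
      have \<theta>: "norm (\<theta> k) \<le> norm s * (2 * C * ?W) * inverse (\<kappa> k)" for k
      proof -
        let ?s = "s /\<^sub>R \<rho> k" and ?Y = "X k + v\<^sub>0"
        define L where "L = (\<kappa> k)\<^sup>2"
        have L: "1 \<le> L" using \<kappa>[of k] by (auto simp: L_def)
        have "\<exists>t\<in>{0<..<1}. (\<lambda>t. \<phi> (?Y + t *\<^sub>R ?s)) 1 - (\<lambda>t. \<phi> (?Y + t *\<^sub>R ?s)) 0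
            = (\<lambda>h. h * (?s \<bullet> G (?Y + t *\<^sub>R ?s))) (1 - 0)"
        proof (rule mvt_simple)
          fix t :: real
          have "((\<lambda>r. \<phi> (?Y + r *\<^sub>R ?s)) has_vector_derivative ?s \<bullet> G (?Y + t *\<^sub>R ?s)) (at t)"
            by (rule directional_has_vector_derivative[where F' = "\<lambda>z. ?s \<bullet> G z"])
              (use GDERIV_along[OF grad] in \<open>simp only: has_real_derivative_iff_has_vector_derivative\<close>)
          then show "((\<lambda>r. \<phi> (?Y + r *\<^sub>R ?s)) has_derivative (\<lambda>h. h * (?s \<bullet> G (?Y + t *\<^sub>R ?s)))) (at t within {0..1})"
            unfolding has_vector_derivative_def real_scaleR_def by (rule has_derivative_at_withinI)
        qed simp
        then obtain t where t: "0 < t" "t < 1" "\<phi> (?Y + ?s) - \<phi> ?Y = ?s \<bullet> G (?Y + t *\<^sub>R ?s)" by auto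
        have bnd: "norm (G (X k + y) - L ^ (m - 1) *\<^sub>R \<xi>\<^sub>0) \<le> C * L ^ (m - 2) * ?W" if "norm y \<le> norm v\<^sub>0 + norm s" for y
        proof -
          have "norm (G (X k + y) - L ^ (m - 1) *\<^sub>R \<xi>\<^sub>0) \<le> C * L ^ (m - 2) * (1 + norm y) ^ (m - 1)"
            using C'[OF L, of y] by (simp add: X_def L_def)
          also have "\<dots> \<le> C * L ^ (m - 2) * ?W"
            using that C(1) L by (intro mult_left_mono power_mono) auto
          finally show ?thesis .
        qed
        have "norm (t *\<^sub>R ?s) \<le> 1 * norm s"
          unfolding norm_scaleR[of t ?s] by (rule mult_mono[OF _ s\<rho>]) (use t in auto)
        then have y1: "norm (v\<^sub>0 + t *\<^sub>R ?s) \<le> norm v\<^sub>0 + norm s"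
          using norm_triangle_ineq[of v\<^sub>0 "t *\<^sub>R ?s"] by linarith
        have "norm (G (?Y + t *\<^sub>R ?s) - G ?Y) \<le> 2 * (C * L ^ (m - 2) * ?W)"
        proof -
          have "norm (G (?Y + t *\<^sub>R ?s) - G ?Y)
             \<le> norm (G (?Y + t *\<^sub>R ?s) - L ^ (m - 1) *\<^sub>R \<xi>\<^sub>0) + norm (G ?Y - L ^ (m - 1) *\<^sub>R \<xi>\<^sub>0)"
            using norm_triangle_ineq4[of "G (?Y + t *\<^sub>R ?s) - L ^ (m - 1) *\<^sub>R \<xi>\<^sub>0" "G ?Y - L ^ (m - 1) *\<^sub>R \<xi>\<^sub>0"]
            by simp
          then show ?thesis using bnd[OF y1] bnd[of v\<^sub>0] by (simp add: add.assoc)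
        qed
        moreover have "\<theta> k = ?s \<bullet> (G (?Y + t *\<^sub>R ?s) - G ?Y)"
          unfolding \<theta>_def \<xi>_def inner_diff_right t(3)[symmetric] by simp
        ultimately have "norm (\<theta> k) \<le> norm ?s * (2 * (C * L ^ (m - 2) * ?W))"
          unfolding real_norm_def
          by (simp only:) (rule order_trans[OF Cauchy_Schwarz_ineq2 mult_left_mono[OF _ norm_ge_zero]])
        also have "norm ?s = norm s * inverse (L ^ (m - 2) * \<kappa> k)"
          unfolding L_def pow1 using \<rho>(2)[of k] by (simp add: divide_inverse mult.commute)
        also have "norm s * inverse (L ^ (m - 2) * \<kappa> k) * (2 * (C * L ^ (m - 2) * ?W))
           = norm s * (2 * C * ?W) * inverse (\<kappa> k)"
        proof -
          have "n * inverse (P * K) * (2 * (C * P * w)) = n * (2 * C * w) * inverse K"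
            if "P \<noteq> 0" "K \<noteq> 0" for n P K w :: real
            using that by (simp add: field_simps)
          then show ?thesis using L \<kappa>(2)[of k] by simp
        qed
        finally show ?thesis .
      qed
      have "(\<lambda>k. norm s * (2 * C * ?W) * inverse (\<kappa> k)) \<longlonglongrightarrow> 0"
        by (rule tendsto_mult_right_zero[OF inv\<kappa>])
      then have "\<theta> \<longlonglongrightarrow> 0"
        by (rule Lim_null_comparison[rotated]) (use \<theta> in simp)
      moreover have "(\<lambda>k. s /\<^sub>R \<rho> k) \<longlonglongrightarrow> 0"
      proof (rule Lim_null_comparison[where g = "\<lambda>k. norm s * inverse (\<kappa> k)"], rule always_eventually, rule allI)
        fix k
        have "\<kappa> k ^ 1 \<le> \<rho> k" unfolding \<rho>_def using \<kappa>[of k] m by (intro power_increasing) (auto simp: q_def)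
        then have "inverse (\<rho> k) \<le> inverse (\<kappa> k)" using \<kappa>[of k] by (intro le_imp_inverse_le) auto
        then have "norm s * inverse (\<rho> k) \<le> norm s * inverse (\<kappa> k)" by (intro mult_left_mono) auto
        then show "norm (s /\<^sub>R \<rho> k) \<le> norm s * inverse (\<kappa> k)"
          using \<rho>(2)[of k] by (simp add: divide_inverse mult.commute)
      qed (rule tendsto_mult_right_zero[OF inv\<kappa>])
      then have "(\<lambda>k. \<psi> (v\<^sub>0 + s /\<^sub>R \<rho> k)) \<longlonglongrightarrow> \<psi> v\<^sub>0"
        using continuous_on_tendsto_compose[OF schwartz_continuous[OF \<psi>(1)] tendsto_add[OF tendsto_const[of v\<^sub>0]]] by fastforce
      ultimately have "(\<lambda>k. exp (\<i> * complex_of_real (\<theta> k)) * cnj (\<psi> (v\<^sub>0 + s /\<^sub>R \<rho> k)) * complex_of_real (exp (- (norm s)\<^sup>2 / 2)))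
         \<longlonglongrightarrow> exp (\<i> * complex_of_real 0) * cnj (\<psi> v\<^sub>0) * complex_of_real (exp (- (norm s)\<^sup>2 / 2))"
        by (intro tendsto_intros)
      moreover have "?b k s = exp (\<i> * complex_of_real (\<theta> k)) * cnj (\<psi> (v\<^sub>0 + s /\<^sub>R \<rho> k)) * complex_of_real (exp (- (norm s)\<^sup>2 / 2))" for k
      proof -
        have "exp (- (\<i> * complex_of_real (\<phi> (X k + v\<^sub>0)))) * exp (\<i> * complex_of_real (\<phi> (X k + v\<^sub>0 + s /\<^sub>R \<rho> k) - (s /\<^sub>R \<rho> k) \<bullet> \<xi> k))
          = exp (\<i> * complex_of_real (\<theta> k))"
          unfolding exp_add[symmetric] \<theta>_def by (rule arg_cong[of _ _ exp]) (simp add: algebra_simps)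
        then show ?thesis unfolding b_def by (simp only: mult.assoc[symmetric])
      qed
      ultimately show "(\<lambda>k. ?b k s) \<longlonglongrightarrow> ?lim s" by simp
    qed
  qed
  have "norm (LINT s|lborel. ?b k s) = norm (LINT w|lborel. a k w)" for k
    unfolding integral_mult_right_zero ab by (simp add: norm_mult)
  then have "(\<lambda>k. norm (LINT w|lborel. a k w)) \<longlonglongrightarrow> norm (LINT s|lborel. ?lim s)"
    using tendsto_norm[OF blim] by simp
  then have "norm (LINT s|lborel. ?lim s) = 0"
    by (rule LIMSEQ_unique) (rule a0)
  moreover have "(LINT s|lborel. ?lim s) = cnj (\<psi> v\<^sub>0) * complex_of_real ((2 * pi) powr (real ?d / 2))"
    using gaussian_fourier_transform[of "0 :: real ^ 'n"] by (simp add: integral_mult_right_zero)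
  ultimately show False using v0 by simp
qed

text \<open>At \<open>x = 0\<close> the gradient of a form of degree \<open>m \<ge> 2\<close> vanishes, so that the graph meets this fibre only in
  the origin, which never belongs to a wave front set.\<close>

theorem WFg_of_polynomial_phase:
  fixes c :: "('n::finite \<Rightarrow> nat) \<Rightarrow> real" and \<psi> :: "real ^ 'n \<Rightarrow> complex"
  assumes m: "m \<ge> 2" and \<psi>: "\<psi> \<in> schwartz_space" "\<psi> \<noteq> (\<lambda>x. 0)"
  shows "WFg (real m - 1) \<psi> (distribution_of (\<lambda>y. exp (\<i> * complex_of_real (mi_poly {\<alpha>. mi_order \<alpha> \<le> m} c y))))
    = {(x, mi_poly_grad {\<alpha>. mi_order \<alpha> = m} c x) | x. x \<noteq> 0}"
proof (rule set_eqI, rule iffI)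
  let ?WF = "WFg (real m - 1) \<psi> (distribution_of (\<lambda>y. exp (\<i> * complex_of_real (mi_poly {\<alpha>. mi_order \<alpha> \<le> m} c y))))"
  let ?G = "mi_poly_grad {\<alpha>. mi_order \<alpha> = m} c"
  fix z assume z: "z \<in> ?WF"
  obtain x \<xi> where z_eq: "z = (x, \<xi>)" by (cases z)
  then have \<xi>: "\<xi> = ?G x" using not_in_WFg_off_gradient[OF m \<psi>(1)] z by blast
  have "x \<noteq> 0"
  proof
    assume x: "x = 0"
    have zero: "real (\<alpha> i) * mi_power 0 (mi_dec i \<alpha>) = 0" if "mi_order \<alpha> = m" for \<alpha> and i :: 'n
    proof (cases "\<alpha> i = 0")
      case False
      then have "mi_order (mi_dec i \<alpha>) \<noteq> 0" using mi_order_dec[of \<alpha> i] that m by simp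
      then show ?thesis using mi_power_scaleR[of 0 "0 :: real ^ 'n" "mi_dec i \<alpha>"] by (auto simp: power_0_left)
    qed simp
    have "?G 0 = 0" unfolding mi_poly_grad_def vec_eq_iff
      by (simp only: vec_lambda_beta zero_index, intro allI sum.neutral ballI, simp only: mem_Collect_eq zero mult_zero_right)
    then show False using z z_eq \<xi> x by (simp add: WFg_def zero_prod_def)
  qed
  then show "z \<in> {(x, ?G x) | x. x \<noteq> 0}" using z_eq \<xi> by blast
qed (use in_WFg_on_gradient[OF m \<psi>] in blast)

theorem theorem7p1:
  fixes m :: nat
    and c :: "('n::finite \<Rightarrow> nat) \<Rightarrow> real"
    and \<phi> \<phi>\<^sub>m p :: "real ^ 'n \<Rightarrow> real"
    and u \<psi> :: "real ^ 'n \<Rightarrow> complex"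
  assumes "m \<ge> 2"
    and "\<And>x. \<phi>\<^sub>m x = (\<Sum>\<alpha> | mi_order \<alpha> = m. c \<alpha> * mi_power x \<alpha>)"
    and "\<And>x. p x = (\<Sum>\<alpha> | mi_order \<alpha> < m. c \<alpha> * mi_power x \<alpha>)"
    and "\<exists>\<alpha>. mi_order \<alpha> = m \<and> c \<alpha> \<noteq> 0"
    and "\<And>x. \<phi> x = \<phi>\<^sub>m x + p x"
    and "\<And>x. u x = exp (\<i> * complex_of_real (\<phi> x))"
    and "\<psi> \<in> schwartz_space" and "\<psi> \<noteq> (\<lambda>x. 0)"
  shows "WFg (real m - 1) \<psi> (distribution_of u) \<subseteq> {(x, grad \<phi>\<^sub>m x) | x. x \<noteq> 0} \<and>
    (CARD('n) = 1 \<and> ((\<forall>x. \<phi> (- x) = \<phi> x) \<or> (\<forall>x. \<phi> (- x) = - \<phi> x)) \<longrightarrow>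
      WFg (real m - 1) \<psi> (distribution_of u) = {(x, grad \<phi>\<^sub>m x) | x. x \<noteq> 0})"
proof -
  have \<phi>\<^sub>m: "\<phi>\<^sub>m = mi_poly {\<alpha>. mi_order \<alpha> = m} c"
    using assms(2) by (auto simp: mi_poly_def)
  have "{\<alpha> :: 'n \<Rightarrow> nat. mi_order \<alpha> \<le> m} = {\<alpha>. mi_order \<alpha> = m} \<union> {\<alpha>. mi_order \<alpha> < m}" by auto
  then have "\<phi> x = mi_poly {\<alpha>. mi_order \<alpha> \<le> m} c x" for x
    unfolding assms(2,3,5) mi_poly_def
    by (simp only:) (rule sum.union_disjoint[symmetric], auto simp: finite_mi_order_eq finite_mi_order_less)
  then have u: "u = (\<lambda>y. exp (\<i> * complex_of_real (mi_poly {\<alpha>. mi_order \<alpha> \<le> m} c y)))"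
    using assms(6) by auto
  have "grad \<phi>\<^sub>m x = mi_poly_grad {\<alpha>. mi_order \<alpha> = m} c x" for x
    unfolding \<phi>\<^sub>m by (rule grad_eqI[OF GDERIV_mi_poly])
  then show ?thesis
    using WFg_of_polynomial_phase[OF assms(1,7,8), of c] unfolding u by simp
qed

end
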